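(* Let $(P,N)$ be a Poisson-Nijenhuis structure on a manifold $M$. For all $f\in C^\infty(M)$, $$i_P(d_N\,df)=-\tfrac12\,H^P_{I_1}(f),$$ where $H^P_{I_1}=P\,d\,\mathrm{Tr}N$ is the hamiltonian vector field with hamiltonian $I_1=\mathrm{Tr}N$ in the Poisson structure $P$.
   Context: A bivector $P$ also denotes the map from $1$-forms to vector fields $P\alpha=i_\alpha P$. The hamiltonian vector field of $f$ in the Poisson structure $P$ is $H^P_f=P\,df$. ${}^tN$ is the transpose of the $(1,1)$-tensor $N$, acting on $1$-forms. $i_N$ and $i_P$ denote the interior products by $N$ and by the bivector $P$ acting on differential forms; $i_N$ has degree $0$ and equals ${}^tN$ on $1$-forms, and $i_P$ has degree $-2$. The operator $d_N=[i_N,d]$ (graded commutator) is the differential on forms associated with the deformed bracket of vector fields $[X,Y]_N=[NX,Y]+[X,NY]-N[X,Y]$. For a bivector $Q$, the bracket of $1$-forms defined by $Q$ is $[\alpha,\beta]_Q=L_{Q\alpha}\beta-L_{Q\beta}\alpha-d(Q(\alpha,\beta))$. A Poisson-Nijenhuis structure on $M$ is a pair $(P,N)$, where $P$ is a Poisson bivector and $N$ is a Nijenhuis tensor (a $(1,1)$-tensor with vanishing Nijenhuis torsion), that are compatible, i.e. $N\circ P=P\circ{}^tN$ and, for all $1$-forms $\alpha,\beta$, $$[\alpha,\beta]_{NP}=[{}^tN\alpha,\beta]_P+[\alpha,{}^tN\beta]_P-{}^tN[\alpha,\beta]_P ,$$ where $NP$ is the bivector corresponding to the map $N\circ P$. 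*)

theory Defs
  imports "HOL-Analysis.Analysis"
begin

section \<open>Smooth maps between open subsets of normed spaces\<close>

primrec Ck_on :: "nat \<Rightarrow> ('a::real_normed_vector \<Rightarrow> 'b::real_normed_vector) \<Rightarrow> 'a set \<Rightarrow> bool" where
  "Ck_on 0 f S \<longleftrightarrow> continuous_on S f"
| "Ck_on (Suc k) f S \<longleftrightarrow> (\<forall>x\<in>S. f differentiable (at x)) \<and>
     (\<forall>v. Ck_on k (\<lambda>x. frechet_derivative f (at x) v) S)"

text \<open>Only used for open \<open>S\<close>.\<close>
definition smooth_on :: "('a::real_normed_vector \<Rightarrow> 'b::real_normed_vector) \<Rightarrow> 'a set \<Rightarrow> bool" where
  "smooth_on f S \<longleftrightarrow> (\<forall>k. Ck_on k f S)"


section \<open>Manifolds\<close>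

text \<open>A chart is a pair of its domain and its coordinate map.\<close>
type_synonym ('a, 'n) chart = "'a set \<times> ('a \<Rightarrow> (real, 'n) vec)"

definition chart_inv :: "('a, 'n::finite) chart \<Rightarrow> real^'n \<Rightarrow> 'a" where
  "chart_inv c = inv_into (fst c) (snd c)"

definition chart_range :: "('a, 'n::finite) chart \<Rightarrow> (real^'n) set" where
  "chart_range c = snd c ` fst c"

definition smooth_manifold :: "'a topology \<Rightarrow> ('a, 'n::finite) chart set \<Rightarrow> bool" where
  "smooth_manifold M A \<longleftrightarrow>
     Hausdorff_space M \<and> second_countable M \<and> (\<Union>c\<in>A. fst c) = topspace M \<and>
     (\<forall>c\<in>A. openin M (fst c) \<and> open (chart_range c) \<and>
        homeomorphic_map (subtopology M (fst c)) (top_of_set (chart_range c)) (snd c)) \<and>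
     (\<forall>c\<in>A. \<forall>c'\<in>A. smooth_on (snd c' \<circ> chart_inv c) (snd c ` (fst c \<inter> fst c')))"

definition smooth_fun :: "('a, 'n::finite) chart set \<Rightarrow> ('a \<Rightarrow> real) \<Rightarrow> bool" where
  "smooth_fun A f \<longleftrightarrow> (\<forall>c\<in>A. smooth_on (f \<circ> chart_inv c) (chart_range c))"

text \<open>Derivative at the point \<open>p\<close>, in the direction with components \<open>v\<close> in the chart \<open>c\<close>.\<close>
definition chart_deriv ::
  "('a, 'n::finite) chart \<Rightarrow> ('a \<Rightarrow> 'b::real_normed_vector) \<Rightarrow> 'a \<Rightarrow> real^'n \<Rightarrow> 'b" where
  "chart_deriv c h p v = frechet_derivative (h \<circ> chart_inv c) (at (snd c p)) v"

definition transition_jacobian :: "('a, 'n::finite) chart \<Rightarrow> ('a, 'n) chart \<Rightarrow> 'a \<Rightarrow> real^'n^'n" where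
  "transition_jacobian c c' p = jacobian (snd c' \<circ> chart_inv c) (at (snd c p))"


section \<open>Tensor fields\<close>

text \<open>
  A tensor field is given by its components in every chart of the atlas, as functions of the
  point of the manifold; the components in two charts are related by the transformation law of
  the respective type of tensor. Values for a chart outside the atlas, or at a point outside the
  domain of the chart, carry no meaning: equality of fields is \<open>vf_eq\<close> or \<open>form_eq\<close>.

  With \<open>i\<close> the row and \<open>j\<close> the column index, a (1,1)-tensor field has the components
  \<open>N\<^sup>i\<^sub>j = dx\<^sup>i(N \<partial>\<^sub>j)\<close> and a bivector field the components \<open>P\<^sup>i\<^sup>j = P(dx\<^sup>i, dx\<^sup>j)\<close>.
  A differential form is, in each chart and at each point, a function of the list of its vector
  arguments; a form of degree \<open>k\<close> is nonzero only on lists of length \<open>k\<close>.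
\<close>

type_synonym ('a, 'n) vfield = "('a, 'n) chart \<Rightarrow> 'a \<Rightarrow> (real, 'n) vec"
type_synonym ('a, 'n) matfield = "('a, 'n) chart \<Rightarrow> 'a \<Rightarrow> ((real, 'n) vec, 'n) vec"
type_synonym ('a, 'n) form = "('a, 'n) chart \<Rightarrow> 'a \<Rightarrow> (real, 'n) vec list \<Rightarrow> real"

definition vector_field :: "('a, 'n::finite) chart set \<Rightarrow> ('a, 'n) vfield \<Rightarrow> bool" where
  "vector_field A X \<longleftrightarrow>
     (\<forall>c\<in>A. smooth_on (X c \<circ> chart_inv c) (chart_range c)) \<and>
     (\<forall>c\<in>A. \<forall>c'\<in>A. \<forall>p\<in>fst c \<inter> fst c'. X c' p = transition_jacobian c c' p *v X c p)"

definition tensor11_field :: "('a, 'n::finite) chart set \<Rightarrow> ('a, 'n) matfield \<Rightarrow> bool" where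
  "tensor11_field A N \<longleftrightarrow>
     (\<forall>c\<in>A. smooth_on (N c \<circ> chart_inv c) (chart_range c)) \<and>
     (\<forall>c\<in>A. \<forall>c'\<in>A. \<forall>p\<in>fst c \<inter> fst c'.
        N c' p ** transition_jacobian c c' p = transition_jacobian c c' p ** N c p)"

definition bivector_field :: "('a, 'n::finite) chart set \<Rightarrow> ('a, 'n) matfield \<Rightarrow> bool" where
  "bivector_field A P \<longleftrightarrow>
     (\<forall>c\<in>A. smooth_on (P c \<circ> chart_inv c) (chart_range c)) \<and>
     (\<forall>c\<in>A. \<forall>p\<in>fst c. transpose (P c p) = - P c p) \<and>
     (\<forall>c\<in>A. \<forall>c'\<in>A. \<forall>p\<in>fst c \<inter> fst c'.
        P c' p = transition_jacobian c c' p ** P c p ** transpose (transition_jacobian c c' p))"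

definition diff_form :: "('a, 'n::finite) chart set \<Rightarrow> nat \<Rightarrow> ('a, 'n) form \<Rightarrow> bool" where
  "diff_form A k \<omega> \<longleftrightarrow>
     (\<forall>c\<in>A. \<forall>vs. smooth_on (\<lambda>x. \<omega> c (chart_inv c x) vs) (chart_range c)) \<and>
     (\<forall>c\<in>A. \<forall>p\<in>fst c. \<forall>vs.
        (length vs \<noteq> k \<longrightarrow> \<omega> c p vs = 0) \<and>
        (\<forall>i < length vs. linear (\<lambda>v. \<omega> c p (vs[i := v]))) \<and>
        (\<not> distinct vs \<longrightarrow> \<omega> c p vs = 0)) \<and>
     (\<forall>c\<in>A. \<forall>c'\<in>A. \<forall>p\<in>fst c \<inter> fst c'. \<forall>vs.
        \<omega> c p vs = \<omega> c' p (map ((*v) (transition_jacobian c c' p)) vs))"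

definition vf_eq :: "('a, 'n::finite) chart set \<Rightarrow> ('a, 'n) vfield \<Rightarrow> ('a, 'n) vfield \<Rightarrow> bool" where
  "vf_eq A X Y \<longleftrightarrow> (\<forall>c\<in>A. \<forall>p\<in>fst c. X c p = Y c p)"

definition form_eq :: "('a, 'n::finite) chart set \<Rightarrow> ('a, 'n) form \<Rightarrow> ('a, 'n) form \<Rightarrow> bool" where
  "form_eq A \<omega> \<eta> \<longleftrightarrow> (\<forall>c\<in>A. \<forall>p\<in>fst c. \<forall>vs. \<omega> c p vs = \<eta> c p vs)"

text \<open>Functions as forms of degree 0; \<open>g\<close> may be given by an expression in each chart.\<close>
definition zero_form :: "(('a, 'n::finite) chart \<Rightarrow> 'a \<Rightarrow> real) \<Rightarrow> ('a, 'n) form" where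
  "zero_form g c p vs = (if vs = [] then g c p else 0)"

definition fun_form :: "('a \<Rightarrow> real) \<Rightarrow> ('a, 'n::finite) form" where
  "fun_form f = zero_form (\<lambda>c. f)"


section \<open>Cartan calculus\<close>

definition vf_apply :: "('a, 'n::finite) vfield \<Rightarrow> ('a \<Rightarrow> real) \<Rightarrow> ('a, 'n) chart \<Rightarrow> 'a \<Rightarrow> real" where
  "vf_apply X f c p = chart_deriv c f p (X c p)"

definition lie_bracket :: "('a, 'n::finite) vfield \<Rightarrow> ('a, 'n) vfield \<Rightarrow> ('a, 'n) vfield" where
  "lie_bracket X Y c p = chart_deriv c (Y c) p (X c p) - chart_deriv c (X c) p (Y c p)"

text \<open>
  The usual formula for the exterior derivative, for arguments which are constant in the chart
  (so that their Lie brackets vanish); no factor \<open>1/(k+1)\<close>.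
\<close>
definition ext_d :: "('a, 'n::finite) form \<Rightarrow> ('a, 'n) form" where
  "ext_d \<omega> c p vs =
     (\<Sum>i<length vs. (-1) ^ i * chart_deriv c (\<lambda>q. \<omega> c q (take i vs @ drop (Suc i) vs)) p (vs ! i))"

definition int_vf :: "('a, 'n::finite) vfield \<Rightarrow> ('a, 'n) form \<Rightarrow> ('a, 'n) form" where
  "int_vf X \<omega> c p vs = \<omega> c p (X c p # vs)"

definition lie_deriv :: "('a, 'n::finite) vfield \<Rightarrow> ('a, 'n) form \<Rightarrow> ('a, 'n) form" where
  "lie_deriv X \<omega> c p vs = int_vf X (ext_d \<omega>) c p vs + ext_d (int_vf X \<omega>) c p vs"

definition int_N :: "('a, 'n::finite) matfield \<Rightarrow> ('a, 'n) form \<Rightarrow> ('a, 'n) form" where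
  "int_N N \<omega> c p vs = (\<Sum>i<length vs. \<omega> c p (vs[i := N c p *v (vs ! i)]))"

text \<open>The graded commutator of \<open>i\<^sub>N\<close> and \<open>d\<close>, where \<open>i\<^sub>N\<close> has degree 0.\<close>
definition d_N :: "('a, 'n::finite) matfield \<Rightarrow> ('a, 'n) form \<Rightarrow> ('a, 'n) form" where
  "d_N N \<omega> c p vs = int_N N (ext_d \<omega>) c p vs - ext_d (int_N N \<omega>) c p vs"

text \<open>
  Normalised such that \<open>i\<^sub>P(\<alpha> \<and> \<beta>) = P(\<alpha>, \<beta>)\<close> for 1-forms, that is,
  \<open>i\<^bsub>X \<and> Y\<^esub> \<omega> = \<omega>(X, Y, \<dots>)\<close>.
\<close>
definition int_P :: "('a, 'n::finite) matfield \<Rightarrow> ('a, 'n) form \<Rightarrow> ('a, 'n) form" where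
  "int_P P \<omega> c p vs =
     1/2 * (\<Sum>i\<in>UNIV. \<Sum>j\<in>UNIV. P c p $ i $ j * \<omega> c p (axis i 1 # axis j 1 # vs))"

definition act_N :: "('a, 'n::finite) matfield \<Rightarrow> ('a, 'n) vfield \<Rightarrow> ('a, 'n) vfield" where
  "act_N N X c p = N c p *v X c p"

text \<open>For forms of degree 1.\<close>
definition transpose_N :: "('a, 'n::finite) matfield \<Rightarrow> ('a, 'n) form \<Rightarrow> ('a, 'n) form" where
  "transpose_N N \<alpha> c p vs = \<alpha> c p (map ((*v) (N c p)) vs)"

definition trace_N :: "('a, 'n::finite) matfield \<Rightarrow> ('a, 'n) form" where
  "trace_N N = zero_form (\<lambda>c p. trace (N c p))"


section \<open>Bivectors\<close>

definition covec :: "('a, 'n::finite) form \<Rightarrow> ('a, 'n) chart \<Rightarrow> 'a \<Rightarrow> real^'n" where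
  "covec \<alpha> c p = (\<chi> i. \<alpha> c p [axis i 1])"

text \<open>The function \<open>Q(\<alpha>, \<beta>)\<close>, for 1-forms.\<close>
definition bivec_pair :: "('a, 'n::finite) matfield \<Rightarrow> ('a, 'n) form \<Rightarrow> ('a, 'n) form \<Rightarrow> ('a, 'n) form" where
  "bivec_pair Q \<alpha> \<beta> =
     zero_form (\<lambda>c p. \<Sum>i\<in>UNIV. \<Sum>j\<in>UNIV. Q c p $ i $ j * covec \<alpha> c p $ i * covec \<beta> c p $ j)"

text \<open>\<open>Q \<alpha> = i\<^sub>\<alpha> Q\<close>, where \<open>\<beta>(Q \<alpha>) = Q(\<alpha>, \<beta>)\<close>.\<close>
definition sharp :: "('a, 'n::finite) matfield \<Rightarrow> ('a, 'n) form \<Rightarrow> ('a, 'n) vfield" where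
  "sharp Q \<alpha> c p = covec \<alpha> c p v* Q c p"

definition hamiltonian_vf :: "('a, 'n::finite) matfield \<Rightarrow> ('a, 'n) form \<Rightarrow> ('a, 'n) vfield" where
  "hamiltonian_vf P h = sharp P (ext_d h)"

definition poisson_bracket :: "('a, 'n::finite) matfield \<Rightarrow> ('a, 'n) form \<Rightarrow> ('a, 'n) form \<Rightarrow> ('a, 'n) form" where
  "poisson_bracket P f g = bivec_pair P (ext_d f) (ext_d g)"

definition poisson_bivector :: "('a, 'n::finite) chart set \<Rightarrow> ('a, 'n) matfield \<Rightarrow> bool" where
  "poisson_bivector A P \<longleftrightarrow> bivector_field A P \<and>
     (\<forall>f g h. smooth_fun A f \<and> smooth_fun A g \<and> smooth_fun A h \<longrightarrow>
        form_eq A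
          (\<lambda>c p vs. poisson_bracket P (fun_form f) (poisson_bracket P (fun_form g) (fun_form h)) c p vs
            + poisson_bracket P (fun_form g) (poisson_bracket P (fun_form h) (fun_form f)) c p vs
            + poisson_bracket P (fun_form h) (poisson_bracket P (fun_form f) (fun_form g)) c p vs)
          (\<lambda>c p vs. 0))"

definition form_bracket :: "('a, 'n::finite) matfield \<Rightarrow> ('a, 'n) form \<Rightarrow> ('a, 'n) form \<Rightarrow> ('a, 'n) form" where
  "form_bracket Q \<alpha> \<beta> c p vs =
     lie_deriv (sharp Q \<alpha>) \<beta> c p vs - lie_deriv (sharp Q \<beta>) \<alpha> c p vs
     - ext_d (bivec_pair Q \<alpha> \<beta>) c p vs"


section \<open>Poisson-Nijenhuis structures\<close>

definition nijenhuis_torsion ::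
  "('a, 'n::finite) matfield \<Rightarrow> ('a, 'n) vfield \<Rightarrow> ('a, 'n) vfield \<Rightarrow> ('a, 'n) vfield" where
  "nijenhuis_torsion N X Y c p =
     lie_bracket (act_N N X) (act_N N Y) c p
     - act_N N (\<lambda>c p. lie_bracket (act_N N X) Y c p + lie_bracket X (act_N N Y) c p
                      - act_N N (lie_bracket X Y) c p) c p"

definition nijenhuis_tensor :: "('a, 'n::finite) chart set \<Rightarrow> ('a, 'n) matfield \<Rightarrow> bool" where
  "nijenhuis_tensor A N \<longleftrightarrow> tensor11_field A N \<and>
     (\<forall>X Y. vector_field A X \<and> vector_field A Y \<longrightarrow>
        vf_eq A (nijenhuis_torsion N X Y) (\<lambda>c p. 0))"

definition bivec_NP :: "('a, 'n::finite) matfield \<Rightarrow> ('a, 'n) matfield \<Rightarrow> ('a, 'n) matfield" where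
  "bivec_NP N P c p = P c p ** transpose (N c p)"

text \<open>\<open>bivec_NP N P\<close> corresponds to the map \<open>N \<circ> P\<close>.\<close>
lemma sharp_bivec_NP: "sharp (bivec_NP N P) \<alpha> = act_N N (sharp P \<alpha>)"
  by (intro ext)
    (simp add: sharp_def bivec_NP_def act_N_def vector_matrix_mul_assoc [symmetric])

definition PN_compatible :: "('a, 'n::finite) chart set \<Rightarrow> ('a, 'n) matfield \<Rightarrow> ('a, 'n) matfield \<Rightarrow> bool" where
  "PN_compatible A P N \<longleftrightarrow>
     (\<forall>\<alpha>. diff_form A 1 \<alpha> \<longrightarrow> vf_eq A (act_N N (sharp P \<alpha>)) (sharp P (transpose_N N \<alpha>))) \<and>
     (\<forall>\<alpha> \<beta>. diff_form A 1 \<alpha> \<and> diff_form A 1 \<beta> \<longrightarrow>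
        form_eq A (form_bracket (bivec_NP N P) \<alpha> \<beta>)
          (\<lambda>c p vs. form_bracket P (transpose_N N \<alpha>) \<beta> c p vs
                    + form_bracket P \<alpha> (transpose_N N \<beta>) c p vs
                    - transpose_N N (form_bracket P \<alpha> \<beta>) c p vs))"

definition poisson_nijenhuis :: "('a, 'n::finite) chart set \<Rightarrow> ('a, 'n) matfield \<Rightarrow> ('a, 'n) matfield \<Rightarrow> bool" where
  "poisson_nijenhuis A P N \<longleftrightarrow> poisson_bivector A P \<and> nijenhuis_tensor A N \<and> PN_compatible A P N"

end

theory Submission
  imports Defs "HOL-Real_Asymp.Real_Asymp"
begin

text \<open>
  Everything is local, so fix a chart and a point, and write \<open>\<partial>\<^sub>i\<close> for the coordinate derivatives there.
  
  Since \<open>d\<^sub>N df = i\<^sub>N ddf - d(i\<^sub>N df) = - d(N\<^sup>t df)\<close>, the left hand side is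
  \<open>- P\<^sup>i\<^sup>j \<partial>\<^sub>i (N\<^sup>k\<^sub>j \<partial>\<^sub>k f)\<close>. Because \<open>P N\<^sup>t = N P\<close> and \<open>P\<close> is skew, \<open>P N\<^sup>t\<close> is a skew
  matrix, and its contraction with the symmetric Hessian of \<open>f\<close> vanishes. What is left is
  \<open>- P\<^sup>i\<^sup>j (\<partial>\<^sub>i N\<^sup>k\<^sub>j) \<partial>\<^sub>k f\<close>, and the theorem becomes the identity
  \<open>P\<^sup>i\<^sup>j \<partial>\<^sub>i N\<^sup>k\<^sub>j = 1/2 P\<^sup>i\<^sup>k \<partial>\<^sub>i Tr N\<close> (lemma \<open>contracted_derivative_N\<close>).
  
  This identity is a contraction of the compatibility of the brackets. For \<open>\<alpha> = dx\<^sup>a\<close> and \<open>\<beta> = dx\<^sup>b\<close>, the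
  bracket condition is a relation between \<open>P\<close>, \<open>N\<close> and their first derivatives
  (\<open>bracket_compatibility_in_chart\<close>). Contracting \<open>b\<close> with the free form index makes the derivatives of
  \<open>P\<close> cancel and leaves the identity (\<open>trace_identity_from_bracket\<close>).
  
  The compatibility condition speaks of global 1-forms, while \<open>dx\<^sup>a\<close> lives on the chart only.
  A bump function turns \<open>x\<^sup>a\<close> into a smooth function on the manifold that is unchanged near the
  point (\<open>smooth_local_extension\<close>, \<open>coordinate_differential\<close>). The analysis that this and the symmetry of
  the Hessian require, namely the closure properties of \<open>Ck_on\<close>, a smooth bump function and Schwarz's
  theorem, is developed first.
\<close>

section \<open>Calculus of iterated derivatives\<close>

lemma Ck_on_cong:
  assumes "open S" "\<And>x. x \<in> S \<Longrightarrow> f x = g x" "Ck_on k f S"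
  shows "Ck_on k g S"
  using assms(2,3)
proof (induction k arbitrary: f g)
  case 0
  then show ?case using continuous_on_cong by (metis Ck_on.simps(1))
next
  case (Suc k)
  have D: "(g has_derivative frechet_derivative f (at x)) (at x)" if "x \<in> S" for x
  proof -
    have "(f has_derivative frechet_derivative f (at x)) (at x)"
      using Suc.prems(2) that by (simp add: frechet_derivative_works [symmetric])
    then show ?thesis
      using has_derivative_transform_within_open assms(1) that Suc.prems(1) by metis
  qed
  have "Ck_on k (\<lambda>x. frechet_derivative g (at x) v) S" for v
  proof (rule Suc.IH)
    show "frechet_derivative f (at x) v = frechet_derivative g (at x) v" if "x \<in> S" for x
      using frechet_derivative_at [OF D [OF that]] by simp
  qed (use Suc.prems in auto)
  then show ?case using D by (auto simp: differentiable_def)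
qed

text \<open>
  Smoothness is local: this is what allows a function that is given by different expressions on
  different open sets to be smooth.
\<close>
lemma Ck_on_Union:
  assumes "\<And>T. T \<in> \<T> \<Longrightarrow> open T" "\<And>T. T \<in> \<T> \<Longrightarrow> Ck_on k f T"
  shows "Ck_on k f (\<Union>\<T>)"
  using assms(2)
proof (induction k arbitrary: f)
  case 0
  then show ?case
    using continuous_on_open_Union [of \<T> f] assms(1) by auto
qed auto

lemma Ck_on_Suc_imp: "Ck_on (Suc k) f S \<Longrightarrow> Ck_on k f S"
proof (induction k arbitrary: f)
  case 0
  then show ?case
    by (auto intro!: continuous_at_imp_continuous_on differentiable_imp_continuous_within)
qed simp

lemma Ck_on_SucI:
  assumes "open S" "\<And>x. x \<in> S \<Longrightarrow> (f has_derivative f' x) (at x)"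
    "\<And>v. Ck_on k (\<lambda>x. f' x v) S"
  shows "Ck_on (Suc k) f S"
proof -
  have "Ck_on k (\<lambda>x. frechet_derivative f (at x) v) S" for v
    by (rule Ck_on_cong [OF assms(1) _ assms(3)]) (simp add: frechet_derivative_at [OF assms(2), symmetric])
  then show ?thesis using assms(2) by (auto simp: differentiable_def)
qed

lemma Ck_on_SucD:
  assumes "Ck_on (Suc k) f S" "x \<in> S"
  shows "(f has_derivative frechet_derivative f (at x)) (at x)"
  using assms by (simp add: frechet_derivative_works [symmetric])

lemma Ck_on_const: "open S \<Longrightarrow> Ck_on k (\<lambda>x. c) S"
proof (induction k arbitrary: c)
  case (Suc k)
  then show ?case using Ck_on_SucI [OF Suc.prems has_derivative_const] by blast
qed auto

lemma Ck_on_bounded_linear: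
  assumes "bounded_linear L" "open S" "Ck_on k f S"
  shows "Ck_on k (\<lambda>x. L (f x)) S"
  using assms(3)
proof (induction k arbitrary: f)
  case 0
  then show ?case using assms(1) by (auto intro: bounded_linear.continuous_on)
next
  case (Suc k)
  show ?case
  proof (rule Ck_on_SucI [OF assms(2)])
    show "((\<lambda>x. L (f x)) has_derivative (\<lambda>v. L (frechet_derivative f (at x) v))) (at x)"
      if "x \<in> S" for x
      using bounded_linear.has_derivative [OF assms(1)] Ck_on_SucD [OF Suc.prems that] .
  qed (use Suc in auto)
qed

lemma Ck_on_add:
  assumes "open S" "Ck_on k f S" "Ck_on k g S"
  shows "Ck_on k (\<lambda>x. f x + g x) S"
  using assms(2,3)
proof (induction k arbitrary: f g)
  case (Suc k)
  show ?case
    by (rule Ck_on_SucI [OF assms(1) has_derivative_add])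
      (use Suc in \<open>auto intro!: Ck_on_SucD simp del: Ck_on.simps(2)\<close>, use Suc in auto)
qed (auto intro: continuous_intros)

lemma Ck_on_scaleR:
  fixes r :: "'a::real_normed_vector \<Rightarrow> real"
  assumes "open S" "Ck_on k r S" "Ck_on k f S"
  shows "Ck_on k (\<lambda>x. r x *\<^sub>R f x) S"
  using assms(2,3)
proof (induction k arbitrary: r f)
  case (Suc k)
  show ?case
  proof (rule Ck_on_SucI [OF assms(1) has_derivative_scaleR])
    show "Ck_on k (\<lambda>x. r x *\<^sub>R frechet_derivative f (at x) v + frechet_derivative r (at x) v *\<^sub>R f x) S" for v
      using Suc Ck_on_Suc_imp [OF Suc.prems(1)] Ck_on_Suc_imp [OF Suc.prems(2)]
      by (intro Ck_on_add assms(1)) auto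
  qed (use Suc.prems in \<open>auto intro!: Ck_on_SucD simp del: Ck_on.simps(2)\<close>)
qed (auto intro: continuous_intros)

lemma Ck_on_diff:
  assumes "open S" "Ck_on k f S" "Ck_on k g S"
  shows "Ck_on k (\<lambda>x. f x - g x) S"
  using Ck_on_add [OF assms(1,2) Ck_on_scaleR [OF assms(1) Ck_on_const [OF assms(1), of k "- 1"] assms(3)]]
  by simp

lemma Ck_on_mult:
  fixes r s :: "'a::real_normed_vector \<Rightarrow> real"
  assumes "open S" "Ck_on k r S" "Ck_on k s S"
  shows "Ck_on k (\<lambda>x. r x * s x) S"
  using Ck_on_scaleR [OF assms] by simp

lemma Ck_on_sum:
  assumes "open S" "\<And>i. i \<in> I \<Longrightarrow> Ck_on k (f i) S"
  shows "Ck_on k (\<lambda>x. \<Sum>i\<in>I. f i x) S"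
  using assms(2)
  by (induction I rule: infinite_finite_induct)
    (use assms(1) in \<open>auto simp: Ck_on_const intro!: Ck_on_add\<close>)

text \<open>
  Expanding the inner derivative in an orthonormal basis turns the chain rule into a finite sum of
  products, in which the outer derivative is only ever applied to fixed vectors. The induction on
  \<open>k\<close> then applies to each factor.
\<close>
lemma Ck_on_compose:
  fixes f :: "'b::euclidean_space \<Rightarrow> 'c::real_normed_vector"
    and g :: "'a::real_normed_vector \<Rightarrow> 'b"
  assumes "open S" "open T" "g ` S \<subseteq> T" "Ck_on k f T" "Ck_on k g S"
  shows "Ck_on k (\<lambda>x. f (g x)) S"
  using assms(4,5)
proof (induction k arbitrary: f)
  case 0
  then show ?case
    using assms(3) continuous_on_compose2 by auto
next
  case (Suc k)
  have D: "(f has_derivative frechet_derivative f (at (g x))) (at (g x))" if "x \<in> S" for x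
    using Ck_on_SucD [OF Suc.prems(1)] that assms(3) by blast
  have lin: "frechet_derivative f (at (g x)) w
      = (\<Sum>b\<in>Basis. (w \<bullet> b) *\<^sub>R frechet_derivative f (at (g x)) b)" if "x \<in> S" for x w
  proof -
    have L: "linear (frechet_derivative f (at (g x)))"
      using has_derivative_linear [OF D [OF that]] .
    have "frechet_derivative f (at (g x)) (\<Sum>b\<in>Basis. (w \<bullet> b) *\<^sub>R b)
        = (\<Sum>b\<in>Basis. (w \<bullet> b) *\<^sub>R frechet_derivative f (at (g x)) b)"
      by (simp only: linear_sum [OF L] linear_cmul [OF L])
    then show ?thesis by (simp only: euclidean_representation)
  qed
  show ?case
  proof (rule Ck_on_SucI [OF assms(1)])
    fix x assume x: "x \<in> S"
    show "((\<lambda>x. f (g x)) has_derivative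
       (\<lambda>v. \<Sum>b\<in>Basis. (frechet_derivative g (at x) v \<bullet> b) *\<^sub>R frechet_derivative f (at (g x)) b)) (at x)"
      unfolding lin [OF x, symmetric]
      using has_derivative_compose [OF Ck_on_SucD [OF Suc.prems(2) x] D [OF x]] .
  next
    fix v
    show "Ck_on k (\<lambda>x. \<Sum>b\<in>Basis. (frechet_derivative g (at x) v \<bullet> b) *\<^sub>R frechet_derivative f (at (g x)) b) S"
    proof (intro Ck_on_sum Ck_on_scaleR assms(1))
      fix b :: 'b
      show "Ck_on k (\<lambda>x. frechet_derivative g (at x) v \<bullet> b) S"
        by (rule Ck_on_bounded_linear [OF bounded_linear_inner_left assms(1)])
          (use Suc.prems in auto)
      show "Ck_on k (\<lambda>x. frechet_derivative f (at (g x)) b) S"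
        by (rule Suc.IH) (use Suc.prems Ck_on_Suc_imp [OF Suc.prems(2)] in auto)
    qed
  qed
qed

text \<open>
  The second difference of \<open>f\<close> on a small parallelogram is a second derivative at a point of
  it, by the mean value theorem in one direction and then in the other. The second difference is
  symmetric in the two directions, so the same quantity is also the other mixed derivative
  at a (possibly different) point; shrinking the parallelogram gives Schwarz's theorem.
\<close>
lemma second_difference_mean_value:
  fixes f :: "'a::real_normed_vector \<Rightarrow> real"
  assumes f: "Ck_on (Suc (Suc 0)) f S" and h: "h > 0"
    and S: "\<And>s t. 0 \<le> s \<Longrightarrow> s \<le> h \<Longrightarrow> 0 \<le> t \<Longrightarrow> t \<le> h \<Longrightarrow> x + s *\<^sub>R v + t *\<^sub>R w \<in> S"
  obtains s t where "0 \<le> s" "s \<le> h" "0 \<le> t" "t \<le> h"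
    "f (x + h *\<^sub>R v + h *\<^sub>R w) - f (x + h *\<^sub>R v) - f (x + h *\<^sub>R w) + f x
     = h\<^sup>2 * frechet_derivative (\<lambda>y. frechet_derivative f (at y) v) (at (x + s *\<^sub>R v + t *\<^sub>R w)) w"
proof -
  let ?D = "\<lambda>y. frechet_derivative f (at y)"
  have Df: "(f has_derivative ?D y) (at y)" if "y \<in> S" for y
    using Ck_on_SucD [OF f that] .
  have along: "((\<lambda>s. F (a + s *\<^sub>R u)) has_real_derivative F' u) (at s)"
    if "(F has_derivative F') (at (a + s *\<^sub>R u))" for F :: "'a \<Rightarrow> real" and F' a u s
  proof -
    have "((\<lambda>s. a + s *\<^sub>R u) has_derivative (\<lambda>r. r *\<^sub>R u)) (at s)"
      by (auto intro!: derivative_eq_intros)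
    from has_derivative_compose [OF this that]
    show ?thesis
      using linear_cmul [OF has_derivative_linear [OF that]]
      by (simp add: has_field_derivative_def mult.commute [of _ "F' u"])
  qed
  define g where "g s = f ((x + h *\<^sub>R w) + s *\<^sub>R v) - f (x + s *\<^sub>R v)" for s
  have "(g has_real_derivative ?D ((x + h *\<^sub>R w) + s *\<^sub>R v) v - ?D (x + s *\<^sub>R v) v) (at s)"
    if "0 \<le> s" "s \<le> h" for s
    unfolding g_def
    using that S [of s h] S [of s 0] h
    by (intro DERIV_diff along Df) (auto simp: algebra_simps)
  from MVT2 [OF h this]
  obtain s where s: "0 < s" "s < h"
    and gs: "g h - g 0 = h * (?D ((x + h *\<^sub>R w) + s *\<^sub>R v) v - ?D (x + s *\<^sub>R v) v)"
    by auto
  have "((\<lambda>t. ?D ((x + s *\<^sub>R v) + t *\<^sub>R w) v) has_real_derivative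
      frechet_derivative (\<lambda>y. ?D y v) (at ((x + s *\<^sub>R v) + t *\<^sub>R w)) w) (at t)"
    if "0 \<le> t" "t \<le> h" for t
    by (rule along) (use f S [of s t] s that in \<open>auto simp: frechet_derivative_works [symmetric]\<close>)
  from MVT2 [OF h this]
  obtain t where t: "0 < t" "t < h"
    and gt: "?D ((x + s *\<^sub>R v) + h *\<^sub>R w) v - ?D ((x + s *\<^sub>R v) + 0 *\<^sub>R w) v
      = h * frechet_derivative (\<lambda>y. ?D y v) (at ((x + s *\<^sub>R v) + t *\<^sub>R w)) w"
    by auto
  show thesis
    by (rule that [of s t])
      (use s t gs gt in \<open>auto simp: g_def power2_eq_square algebra_simps\<close>)
qed

lemma second_derivative_symmetric:
  fixes f :: "'a::real_normed_vector \<Rightarrow> real"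
  assumes f: "Ck_on (Suc (Suc 0)) f S" and "open S" "x \<in> S"
  shows "frechet_derivative (\<lambda>y. frechet_derivative f (at y) v) (at x) w
       = frechet_derivative (\<lambda>y. frechet_derivative f (at y) w) (at x) v"
    (is "?A x = ?B x")
proof (rule ccontr)
  assume ne: "?A x \<noteq> ?B x"
  define e where "e = \<bar>?A x - ?B x\<bar> / 2"
  have e: "e > 0" using ne by (simp add: e_def)
  have near_value: "\<exists>d>0. \<forall>y. dist y x < d \<longrightarrow> dist (g y) (g x) < e"
    if "continuous_on S g" for g :: "'a \<Rightarrow> real"
    using that assms(2,3) e
    by (simp add: continuous_on_eq_continuous_at continuous_at_eps_delta)
  have "continuous_on S ?A" "continuous_on S ?B" using f by auto
  from this [THEN near_value]
  obtain dA dB where d: "dA > 0" "\<And>y. dist y x < dA \<Longrightarrow> dist (?A y) (?A x) < e"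
     "dB > 0" "\<And>y. dist y x < dB \<Longrightarrow> dist (?B y) (?B x) < e"
    by blast
  obtain dS where dS: "dS > 0" "ball x dS \<subseteq> S" using assms(2,3) open_contains_ball by blast
  define r where "r = Min {dA, dB, dS}"
  have r: "r > 0" "r \<le> dA" "r \<le> dB" "r \<le> dS" using d dS by (auto simp: r_def)
  define h where "h = r / (2 * (norm v + norm w + 1))"
  have h: "h > 0" using r by (simp add: h_def add_nonneg_pos)
  have near: "dist (x + s *\<^sub>R v + t *\<^sub>R w) x < r"
    if "0 \<le> s" "s \<le> h" "0 \<le> t" "t \<le> h" for s t
  proof -
    have "norm (s *\<^sub>R v + t *\<^sub>R w) \<le> h * norm v + h * norm w"
      using that by (intro norm_triangle_le add_mono) (auto intro: mult_right_mono)
    also have "\<dots> \<le> h * (norm v + norm w + 1)" using h by (simp add: algebra_simps)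
    also have "\<dots> = r / 2"
      using add_nonneg_pos [of "norm v + norm w" 1] by (simp add: h_def field_simps)
    finally have "norm (s *\<^sub>R v + t *\<^sub>R w) < r" using r by simp
    then show ?thesis by (simp add: dist_norm add.assoc)
  qed
  have inS: "x + s *\<^sub>R v + t *\<^sub>R w \<in> S" if "0 \<le> s" "s \<le> h" "0 \<le> t" "t \<le> h" for s t
    using near [OF that] r dS by (auto simp: mem_ball dist_commute subset_iff)
  obtain s t where st: "0 \<le> s" "s \<le> h" "0 \<le> t" "t \<le> h"
    "f (x + h *\<^sub>R v + h *\<^sub>R w) - f (x + h *\<^sub>R v) - f (x + h *\<^sub>R w) + f x = h\<^sup>2 * ?A (x + s *\<^sub>R v + t *\<^sub>R w)"
    by (rule second_difference_mean_value [OF f h inS])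
  obtain s' t' where st': "0 \<le> s'" "s' \<le> h" "0 \<le> t'" "t' \<le> h"
    "f (x + h *\<^sub>R w + h *\<^sub>R v) - f (x + h *\<^sub>R w) - f (x + h *\<^sub>R v) + f x = h\<^sup>2 * ?B (x + s' *\<^sub>R w + t' *\<^sub>R v)"
  proof (rule second_difference_mean_value [OF f h, of x w v])
    show "x + s *\<^sub>R w + t *\<^sub>R v \<in> S" if "0 \<le> s" "s \<le> h" "0 \<le> t" "t \<le> h" for s t
      using inS [OF that(3,4,1,2)] by (simp add: add_ac)
  qed
  have comm: "x + h *\<^sub>R w + h *\<^sub>R v = x + h *\<^sub>R v + h *\<^sub>R w"
    "x + s' *\<^sub>R w + t' *\<^sub>R v = x + t' *\<^sub>R v + s' *\<^sub>R w" by (simp_all add: algebra_simps)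
  have "h\<^sup>2 * ?A (x + s *\<^sub>R v + t *\<^sub>R w) = h\<^sup>2 * ?B (x + t' *\<^sub>R v + s' *\<^sub>R w)"
    using st(5) st'(5) unfolding comm by linarith
  then have "?A (x + s *\<^sub>R v + t *\<^sub>R w) = ?B (x + t' *\<^sub>R v + s' *\<^sub>R w)" using h by simp
  moreover have "dist (?A (x + s *\<^sub>R v + t *\<^sub>R w)) (?A x) < e"
    using near [OF st(1-4)] r d by auto
  moreover have "dist (?B (x + t' *\<^sub>R v + s' *\<^sub>R w)) (?B x) < e"
    using near [OF st'(3,4,1,2)] r d by auto
  ultimately have "dist (?A x) (?B x) < e + e"
    using dist_triangle_less_add [of "?A x" "?A (x + s *\<^sub>R v + t *\<^sub>R w)" e "?B x" e]
    by (simp add: dist_commute)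
  then show False by (simp add: e_def dist_real_def)
qed

section \<open>Bump functions\<close>

text \<open>
  The case \<open>m = 0\<close> is the classical smooth function that is flat at 0. The powers in the
  denominator are there because the family is closed under differentiation, which makes
  smoothness an induction.
\<close>
definition flat :: "nat \<Rightarrow> real \<Rightarrow> real" where
  "flat m t = (if t > 0 then exp (- 1 / t) / t ^ m else 0)"

lemma flat_eq_0_iff: "flat m t = 0 \<longleftrightarrow> t \<le> 0"
  by (auto simp: flat_def)

lemma flat_mono: assumes "s \<le> t" shows "flat 0 s \<le> flat 0 t"
  using assms by (auto simp: flat_def divide_simps)

lemma flat_tendsto_0: "(flat m \<longlongrightarrow> 0) (at 0)"
proof -
  have "((\<lambda>t. exp (- 1 / t) / t ^ m) \<longlongrightarrow> (0::real)) (at_right 0)"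
    by real_asymp
  then have "(flat m \<longlongrightarrow> 0) (at_right 0)"
    by (rule Lim_transform_eventually)
      (auto simp: flat_def eventually_at_filter)
  moreover have "(flat m \<longlongrightarrow> 0) (at_left 0)"
    by (rule Lim_transform_eventually [OF tendsto_const])
      (auto simp: flat_def eventually_at_filter)
  ultimately show ?thesis by (simp add: filterlim_split_at)
qed

lemma flat_has_derivative:
  "(flat m has_real_derivative flat (m + 2) t - real m * flat (m + 1) t) (at t)"
proof -
  consider "t > 0" | "t < 0" | "t = 0" by linarith
  then show ?thesis
  proof cases
    case 1
    have "((\<lambda>t. exp (- 1 / t) / t ^ m) has_real_derivative flat (m + 2) t - real m * flat (m + 1) t) (at t)"
    proof (cases m)
      case 0
      then show ?thesis
        using 1 by (auto intro!: derivative_eq_intros simp: flat_def field_simps power2_eq_square)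
    next
      case (Suc j)
      show ?thesis
        unfolding Suc
        using 1 by (auto intro!: derivative_eq_intros simp: flat_def field_simps power2_eq_square simp del: power_Suc)
          (simp add: field_simps)
    qed
    then show ?thesis
      by (rule has_field_derivative_transform_within_open [of _ _ _ "{0<..}"])
        (use 1 in \<open>auto simp: flat_def\<close>)
  next
    case 2
    have "((\<lambda>t. 0) has_real_derivative flat (m + 2) t - real m * flat (m + 1) t) (at t)"
      using 2 by (auto simp: flat_def)
    then show ?thesis
      by (rule has_field_derivative_transform_within_open [of _ _ _ "{..<0}"])
        (use 2 in \<open>auto simp: flat_def\<close>)
  next
    case 3
    have "((\<lambda>t. (flat m t - flat m 0) / (t - 0)) \<longlongrightarrow> 0) (at 0)"
      by (rule Lim_transform_eventually [OF flat_tendsto_0 [of "Suc m"]])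
        (auto simp: flat_def eventually_at_filter)
    then show ?thesis
      using 3 by (simp add: has_field_derivative_iff flat_def)
  qed
qed

lemma Ck_on_flat: "Ck_on k (flat m) UNIV"
proof (induction k arbitrary: m)
  case 0
  show ?case
    by (simp add: continuous_at_imp_continuous_on DERIV_isCont [OF flat_has_derivative])
next
  case (Suc k)
  show ?case
  proof (rule Ck_on_SucI)
    show "(flat m has_derivative (\<lambda>v. v * (flat (m + 2) t - real m * flat (m + 1) t))) (at t)" for t
      using flat_has_derivative [of m t]
      by (simp add: has_field_derivative_def mult_commute_abs)
    show "Ck_on k (\<lambda>t. v * (flat (m + 2) t - real m * flat (m + 1) t)) UNIV" for v
      by (intro Ck_on_mult Ck_on_diff Ck_on_const Suc open_UNIV)
  qed simp
qed

text \<open>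
  A smooth step from 1 down to 0 that is built from compositions alone, without a quotient of
  functions: the inner \<open>flat\<close> vanishes for \<open>t \<le> 0\<close>, so that the outer argument is then constant, and
  by monotonicity the outer argument is not positive for \<open>t \<ge> 1\<close>.
\<close>
definition step :: "real \<Rightarrow> real" where
  "step t = flat 0 (flat 0 1 - flat 0 t) / flat 0 (flat 0 1)"

lemma step_eq_1: "t \<le> 0 \<Longrightarrow> step t = 1"
  by (simp add: step_def flat_def)

lemma step_eq_0: "t \<ge> 1 \<Longrightarrow> step t = 0"
  using flat_mono [of 1 t] by (simp add: step_def flat_eq_0_iff)

lemma Ck_on_step: "Ck_on k step UNIV"
proof -
  have "Ck_on k (\<lambda>t. flat 0 (flat 0 1 - flat 0 t)) UNIV"
    by (rule Ck_on_compose [where f = "flat 0" and T = UNIV])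
      (auto intro!: Ck_on_flat Ck_on_diff Ck_on_mult Ck_on_const)
  from Ck_on_mult [OF open_UNIV Ck_on_const [OF open_UNIV] this, of "1 / flat 0 (flat 0 1)"]
  show ?thesis by (simp add: step_def [abs_def])
qed

lemma Ck_on_id: "Ck_on k (\<lambda>x. x) UNIV"
  by (induction k) (auto intro!: Ck_on_SucI [OF open_UNIV has_derivative_ident] Ck_on_const simp del: Ck_on.simps(2))

lemma bump_function:
  fixes x0 :: "'a::euclidean_space"
  assumes "r > 0"
  obtains u :: "'a \<Rightarrow> real" where "\<And>k. Ck_on k u UNIV"
    "\<And>x. dist x x0 < r / 2 \<Longrightarrow> u x = 1" "\<And>x. dist x x0 \<ge> r \<Longrightarrow> u x = 0"
proof
  define \<rho> where "\<rho> x = (\<Sum>b\<in>Basis. (x \<bullet> b - x0 \<bullet> b) * (x \<bullet> b - x0 \<bullet> b))" for x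
  have \<rho>: "\<rho> x = (dist x x0)\<^sup>2" for x
  proof -
    have "(dist x x0)\<^sup>2 = (x - x0) \<bullet> (x - x0)"
      by (simp add: dist_norm power2_norm_eq_inner)
    also have "\<dots> = (\<Sum>b\<in>Basis. ((x - x0) \<bullet> b) * ((x - x0) \<bullet> b))"
      by (rule euclidean_inner)
    finally show ?thesis
      by (simp only: \<rho>_def inner_diff_left)
  qed
  \<comment> \<open>The affine function of the squared distance that is 0 at distance \<open>r / 2\<close> and 1 at distance \<open>r\<close>.\<close>
  define \<kappa> where "\<kappa> = 4 / (3 * r\<^sup>2)"
  define u where "u x = step (\<kappa> * \<rho> x - 1 / 3)" for x
  show "Ck_on k u UNIV" for k
    unfolding u_def [abs_def] \<rho>_def
    by (rule Ck_on_compose [where f = step and T = UNIV])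
      (auto intro!: Ck_on_step Ck_on_diff Ck_on_mult Ck_on_const
        Ck_on_sum Ck_on_bounded_linear [OF bounded_linear_inner_left] Ck_on_id)
  show "u x = 1" if "dist x x0 < r / 2" for x
  proof -
    have "(dist x x0)\<^sup>2 \<le> (r / 2)\<^sup>2" using that by (intro power_mono) auto
    then show ?thesis using assms
      by (auto simp: u_def \<kappa>_def \<rho> field_simps power2_eq_square intro!: step_eq_1)
  qed
  show "u x = 0" if "dist x x0 \<ge> r" for x
  proof -
    have "(dist x x0)\<^sup>2 \<ge> r\<^sup>2" using that assms by (intro power_mono) auto
    then show ?thesis using assms
      by (auto simp: u_def \<kappa>_def \<rho> field_simps power2_eq_square intro!: step_eq_0)
  qed
qed

section \<open>Coordinate differentials as global forms\<close>

lemma chart_inv_in: "x \<in> chart_range c \<Longrightarrow> chart_inv c x \<in> fst c"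
  by (auto simp: chart_range_def chart_inv_def intro: inv_into_into)

lemma chart_right_inverse: "x \<in> chart_range c \<Longrightarrow> snd c (chart_inv c x) = x"
  by (auto simp: chart_range_def chart_inv_def intro: f_inv_into_f)

lemma chart_range_in: "p \<in> fst c \<Longrightarrow> snd c p \<in> chart_range c"
  by (simp add: chart_range_def)

lemma smooth_funD:
  "smooth_fun A u \<Longrightarrow> c \<in> A \<Longrightarrow> Ck_on k (u \<circ> chart_inv c) (chart_range c)"
  by (simp add: smooth_fun_def smooth_on_def)

locale manifold =
  fixes M :: "'a topology" and A :: "('a, 'n::finite) chart set"
  assumes smooth_manifold: "smooth_manifold M A"
begin

lemma chart_homeomorphism:
  "c \<in> A \<Longrightarrow> homeomorphic_map (subtopology M (fst c)) (top_of_set (chart_range c)) (snd c)"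
  using smooth_manifold by (simp add: smooth_manifold_def)

lemma open_chart_range: "c \<in> A \<Longrightarrow> open (chart_range c)"
  using smooth_manifold by (simp add: smooth_manifold_def)

lemma openin_chart_domain: "c \<in> A \<Longrightarrow> openin M (fst c)"
  using smooth_manifold by (simp add: smooth_manifold_def)

lemma topspace_chart_domain: "c \<in> A \<Longrightarrow> topspace (subtopology M (fst c)) = fst c"
  using openin_subset [OF openin_chart_domain] by (simp add: Int_absorb1)

lemma chart_left_inverse:
  assumes "c \<in> A" "p \<in> fst c"
  shows "chart_inv c (snd c p) = p"
  using homeomorphic_imp_injective_map [OF chart_homeomorphism [OF assms(1)]] assms
  by (simp add: topspace_chart_domain chart_inv_def del: topspace_subtopology)

lemma open_chart_image:
  assumes "c \<in> A" "openin M U" "U \<subseteq> fst c"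
  shows "open (snd c ` U)"
proof -
  have "openin (subtopology M (fst c)) U"
    using assms openin_chart_domain by (simp add: openin_open_subtopology)
  then have "openin (top_of_set (chart_range c)) (snd c ` U)"
    using homeomorphic_imp_open_map [OF chart_homeomorphism [OF assms(1)]]
    by (simp add: open_map_def)
  then show ?thesis
    using open_chart_range [OF assms(1)] by (simp add: openin_open_eq)
qed

lemma smooth_transition:
  "c \<in> A \<Longrightarrow> c' \<in> A \<Longrightarrow> Ck_on k (snd c' \<circ> chart_inv c) (snd c ` (fst c \<inter> fst c'))"
  using smooth_manifold by (simp add: smooth_manifold_def smooth_on_def)

lemma open_overlap_image:
  "c \<in> A \<Longrightarrow> c' \<in> A \<Longrightarrow> open (snd c ` (fst c \<inter> fst c'))"
  by (intro open_chart_image openin_Int openin_chart_domain) auto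

text \<open>
  The Hausdorff property enters here: a compact set in the range of a chart is also closed in the
  whole manifold, so that a function supported in it can be extended by zero.
\<close>
lemma closedin_chart_compact:
  assumes c: "c \<in> A" and K: "compact K" "K \<subseteq> chart_range c"
  shows "closedin M (chart_inv c ` K)"
proof -
  have img: "snd c ` chart_inv c ` K = K"
    unfolding image_image using K(2)
    by (subst image_cong [OF refl chart_right_inverse]) auto
  have sub: "chart_inv c ` K \<subseteq> fst c" using K(2) chart_inv_in by blast
  have "compactin (top_of_set (chart_range c)) K"
    using K by (simp add: compactin_subtopology)
  then have "compactin (subtopology M (fst c)) (chart_inv c ` K)"
    using homeomorphic_map_compactness [OF chart_homeomorphism [OF c], of "chart_inv c ` K"]
    by (simp add: topspace_chart_domain [OF c] sub img del: topspace_subtopology)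
  then show ?thesis
    using smooth_manifold
    by (auto simp: compactin_subtopology smooth_manifold_def intro: compactin_imp_closedin)
qed

text \<open>
  Multiply by a bump function supported in a ball inside the range of the chart and extend by zero.
  In any other chart, the result is smooth on the overlap by the transition maps, and it vanishes
  on the open complement of the support; these two open sets cover the chart.
\<close>
lemma smooth_local_extension:
  fixes \<phi> :: "real^'n \<Rightarrow> real"
  assumes c: "c \<in> A" and p: "p \<in> fst c" and \<phi>: "\<And>k. Ck_on k \<phi> UNIV"
  obtains u V where "smooth_fun A u" "open V" "snd c p \<in> V" "V \<subseteq> chart_range c"
    "\<And>x. x \<in> V \<Longrightarrow> u (chart_inv c x) = \<phi> x"
proof -
  obtain r where r: "r > 0" "cball (snd c p) r \<subseteq> chart_range c"
    using open_contains_cball open_chart_range [OF c] chart_range_in [OF p] by blast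
  obtain \<beta> :: "real^'n \<Rightarrow> real" where \<beta>: "\<And>k. Ck_on k \<beta> UNIV"
    "\<And>x. dist x (snd c p) < r / 2 \<Longrightarrow> \<beta> x = 1" "\<And>x. dist x (snd c p) \<ge> r \<Longrightarrow> \<beta> x = 0"
    using bump_function [OF r(1), of "snd c p"] by blast
  define u where "u q = (if q \<in> fst c then \<beta> (snd c q) * \<phi> (snd c q) else 0)" for q
  define K where "K = chart_inv c ` cball (snd c p) r"
  have closed: "closedin M K"
    unfolding K_def by (rule closedin_chart_compact [OF c compact_cball r(2)])
  have outside: "u q = 0" if "q \<notin> K" for q
  proof (cases "q \<in> fst c")
    case True
    then have "snd c q \<notin> cball (snd c p) r"
      using that chart_left_inverse [OF c True] by (metis K_def image_eqI)
    then show ?thesis using \<beta>(3) by (simp add: u_def dist_commute)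
  qed (simp add: u_def)
  have "smooth_fun A u"
    unfolding smooth_fun_def smooth_on_def
  proof (intro ballI allI)
    fix c' k assume c': "c' \<in> A"
    let ?S1 = "snd c' ` (fst c' \<inter> fst c)" and ?S2 = "snd c' ` (fst c' - K)"
    have o1: "open ?S1" using open_overlap_image [OF c' c] .
    have "fst c' - K = fst c' \<inter> (topspace M - K)"
      using openin_subset [OF openin_chart_domain [OF c']] by auto
    then have o2: "open ?S2"
      using openin_Int [OF openin_chart_domain [OF c'] openin_diff [OF openin_topspace closed]]
      by (intro open_chart_image [OF c']) auto
    have "K \<subseteq> fst c" using r(2) chart_inv_in unfolding K_def by blast
    then have cover: "chart_range c' = \<Union>{?S1, ?S2}" by (auto simp: chart_range_def)
    have T: "Ck_on k (\<lambda>x. snd c (chart_inv c' x)) ?S1"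
      using smooth_transition [OF c' c, of k] by (simp add: comp_def)
    have "Ck_on k (\<lambda>x. \<beta> (snd c (chart_inv c' x)) * \<phi> (snd c (chart_inv c' x))) ?S1"
      by (intro Ck_on_mult o1 Ck_on_compose [OF o1 open_UNIV subset_UNIV _ T] \<phi> \<beta>)
    then have 1: "Ck_on k (u \<circ> chart_inv c') ?S1"
      by (rule Ck_on_cong [OF o1, rotated])
        (auto simp: u_def chart_left_inverse [OF c'])
    have 2: "Ck_on k (u \<circ> chart_inv c') ?S2"
      by (rule Ck_on_cong [OF o2 _ Ck_on_const [OF o2, of k 0]])
        (auto simp: outside chart_left_inverse [OF c'])
    show "Ck_on k (u \<circ> chart_inv c') (chart_range c')"
      unfolding cover using o1 o2 1 2 by (intro Ck_on_Union) auto
  qed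
  moreover have "u (chart_inv c x) = \<phi> x" if "x \<in> ball (snd c p) (r / 2)" for x
  proof -
    have "x \<in> chart_range c" using that r by (auto simp: subset_iff)
    then show ?thesis
      using that \<beta>(2) [of x]
      by (simp add: u_def chart_inv_in chart_right_inverse dist_commute)
  qed
  moreover have "ball (snd c p) (r / 2) \<subseteq> chart_range c" using r by (auto simp: subset_iff)
  ultimately show thesis using that [of u "ball (snd c p) (r / 2)"] r(1) by auto
qed

end

lemma chart_deriv_const [simp]: "chart_deriv c (\<lambda>q. k) p v = 0"
  by (simp add: chart_deriv_def comp_def)

lemma ext_d_singleton: "ext_d \<omega> c p [v] = chart_deriv c (\<lambda>q. \<omega> c q []) p v"
  by (simp add: ext_d_def)

lemma ext_d_pair:
  "ext_d \<omega> c p [v, w] = chart_deriv c (\<lambda>q. \<omega> c q [w]) p v - chart_deriv c (\<lambda>q. \<omega> c q [v]) p w"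
  by (simp add: ext_d_def numeral_2_eq_2 lessThan_Suc)

text \<open>
  The operations on forms are defined on argument lists of every length. The following lemma and its
  analogues for \<open>int_N\<close> and \<open>d_N\<close> confine their values to lists of the right length.
\<close>
lemma ext_d_degree:
  assumes "\<And>q ws. length ws \<noteq> k \<Longrightarrow> \<omega> c q ws = 0" and "length vs \<noteq> Suc k"
  shows "ext_d \<omega> c p vs = 0"
proof -
  have "\<omega> c q (take i vs @ drop (Suc i) vs) = 0" if "i < length vs" for i q
    by (rule assms(1)) (use assms(2) that in auto)
  then show ?thesis by (simp add: ext_d_def)
qed

lemma int_N_degree:
  assumes "\<And>ws. length ws \<noteq> k \<Longrightarrow> \<omega> c p ws = 0" and "length vs \<noteq> k"
  shows "int_N N \<omega> c p vs = 0"
  using assms by (simp add: int_N_def)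

lemma d_N_degree:
  assumes "\<And>c q ws. length ws \<noteq> k \<Longrightarrow> \<omega> c q ws = 0" and "length vs \<noteq> Suc k"
  shows "d_N N \<omega> c p vs = 0"
proof -
  have "ext_d \<omega> c p ws = 0" if "length ws \<noteq> Suc k" for ws
    using assms(1) that by (rule ext_d_degree)
  then have "int_N N (ext_d \<omega>) c p vs = 0"
    using assms(2) by (rule int_N_degree)
  moreover have "int_N N \<omega> c q ws = 0" if "length ws \<noteq> k" for q ws
    using assms(1) that by (rule int_N_degree)
  then have "ext_d (int_N N \<omega>) c p vs = 0"
    using assms(2) by (rule ext_d_degree)
  ultimately show ?thesis by (simp add: d_N_def)
qed

lemma ext_d_fun_form_degree: "length vs \<noteq> 1 \<Longrightarrow> ext_d (fun_form u) c p vs = 0"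
  by (rule ext_d_degree [where k = 0]) (auto simp: fun_form_def zero_form_def)

lemma ext_d_fun_form [simp]: "ext_d (fun_form u) c p [v] = chart_deriv c u p v"
  by (simp add: ext_d_singleton fun_form_def zero_form_def)

lemma int_P_d_N_ext_d_degree:
  assumes "vs \<noteq> []"
  shows "int_P P (d_N N (ext_d (fun_form f))) c p vs = 0"
proof -
  have "d_N N (ext_d (fun_form f)) c p (v # w # vs) = 0" for v w
    by (rule d_N_degree [where k = 1]) (use assms in \<open>simp_all add: ext_d_fun_form_degree\<close>)
  then show ?thesis by (simp add: int_P_def)
qed

context manifold
begin

lemma chart_deriv_transition:
  assumes c: "c \<in> A" "c' \<in> A" and p: "p \<in> fst c \<inter> fst c'" and u: "smooth_fun A u"
  shows "chart_deriv c u p v = chart_deriv c' u p (transition_jacobian c c' p *v v)"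
proof -
  let ?T = "snd c' \<circ> chart_inv c" and ?U = "u \<circ> chart_inv c'" and ?S = "snd c ` (fst c \<inter> fst c')"
  have x: "snd c p \<in> ?S" using p by blast
  have Tx: "?T (snd c p) = snd c' p" using chart_left_inverse c p by auto
  have "?T differentiable (at (snd c p))"
    using smooth_transition [OF c, of "Suc 0"] x by auto
  then have T: "(?T has_derivative (\<lambda>v. transition_jacobian c c' p *v v)) (at (snd c p))"
    by (simp add: jacobian_works transition_jacobian_def)
  have "Ck_on (Suc 0) ?U (chart_range c')"
    using smooth_funD [OF u c(2)] .
  then have "(?U has_derivative frechet_derivative ?U (at (snd c' p))) (at (?T (snd c p)))"
    unfolding Tx by (rule Ck_on_SucD) (use p in \<open>simp add: chart_range_in\<close>)
  from diff_chain_at [OF T this]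
  have "(u \<circ> chart_inv c has_derivative
      frechet_derivative ?U (at (snd c' p)) \<circ> (\<lambda>v. transition_jacobian c c' p *v v)) (at (snd c p))"
    by (rule has_derivative_transform_within_open [OF _ open_overlap_image [OF c] x])
      (auto simp: chart_left_inverse c)
  then show ?thesis
    by (simp add: chart_deriv_def frechet_derivative_at [symmetric])
qed

lemma linear_chart_deriv:
  assumes "c \<in> A" "p \<in> fst c" "smooth_fun A u"
  shows "linear (chart_deriv c u p)"
proof -
  have "Ck_on (Suc 0) (u \<circ> chart_inv c) (chart_range c)"
    using smooth_funD [OF assms(3,1)] .
  then show ?thesis
    unfolding chart_deriv_def [abs_def]
    using has_derivative_linear [OF Ck_on_SucD] chart_range_in [OF assms(2)] by blast
qed

text \<open>
  The compatibility condition quantifies over global 1-forms; differentials of smooth functions are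
  the ones that are fed into it.
\<close>
lemma diff_form_ext_d_fun_form:
  assumes u: "smooth_fun A u"
  shows "diff_form A 1 (ext_d (fun_form u))"
  unfolding diff_form_def
proof (intro conjI ballI allI impI)
  fix c :: "('a, 'n) chart" and vs :: "(real^'n) list"
  assume c: "c \<in> A"
  note o = open_chart_range [OF c]
  show "smooth_on (\<lambda>x. ext_d (fun_form u) c (chart_inv c x) vs) (chart_range c)"
  proof (cases "length vs = 1")
    case True
    then obtain v where v: "vs = [v]" by (auto simp: length_Suc_conv)
    have "Ck_on k (\<lambda>x. frechet_derivative (u \<circ> chart_inv c) (at x) v) (chart_range c)" for k
      using smooth_funD [OF u c, of "Suc k"] by simp
    then have "Ck_on k (\<lambda>x. ext_d (fun_form u) c (chart_inv c x) vs) (chart_range c)" for k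
      by (rule Ck_on_cong [OF o, rotated])
        (simp add: v chart_deriv_def chart_right_inverse)
    then show ?thesis by (simp add: smooth_on_def)
  next
    case False
    then show ?thesis by (simp add: smooth_on_def ext_d_fun_form_degree Ck_on_const [OF o])
  qed
next
  fix c :: "('a, 'n) chart" and p vs
  assume c: "c \<in> A" "p \<in> fst c"
  show "length vs \<noteq> 1 \<Longrightarrow> ext_d (fun_form u) c p vs = 0"
    by (rule ext_d_fun_form_degree)
  show "\<not> distinct vs \<Longrightarrow> ext_d (fun_form u) c p vs = 0"
    by (rule ext_d_fun_form_degree) (auto simp: length_Suc_conv)
  fix i assume "i < length vs"
  show "linear (\<lambda>v. ext_d (fun_form u) c p (vs[i := v]))"
  proof (cases "length vs = 1")
    case True
    then show ?thesis using \<open>i < length vs\<close> linear_chart_deriv [OF c u]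
      by (auto simp: length_Suc_conv)
  qed (simp add: ext_d_fun_form_degree linear_zero)
next
  fix c c' :: "('a, 'n) chart" and p and vs :: "(real^'n) list"
  assume c: "c \<in> A" "c' \<in> A" "p \<in> fst c \<inter> fst c'"
  show "ext_d (fun_form u) c p vs
    = ext_d (fun_form u) c' p (map ((*v) (transition_jacobian c c' p)) vs)"
  proof (cases "length vs = 1")
    case True
    then show ?thesis using chart_deriv_transition [OF c u]
      by (auto simp: length_Suc_conv)
  qed (simp add: ext_d_fun_form_degree)
qed

text \<open>
  A global 1-form that equals \<open>dx\<^sup>a\<close> near a given point. Because its components are constant
  there, identities between global forms can be read off in coordinates without any derivatives of
  the test forms.
\<close>
lemma coordinate_differential:
  assumes c: "c \<in> A" and p: "p \<in> fst c"
  obtains \<alpha> V where "diff_form A 1 \<alpha>" "open V" "snd c p \<in> V" "V \<subseteq> chart_range c"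
    "\<And>x v. x \<in> V \<Longrightarrow> \<alpha> c (chart_inv c x) [v] = axis a 1 \<bullet> v"
proof -
  have "Ck_on k (\<lambda>x::real^'n. x \<bullet> axis a 1) UNIV" for k
    by (intro Ck_on_bounded_linear [OF bounded_linear_inner_left] Ck_on_id open_UNIV)
  then obtain u V where u: "smooth_fun A u" and V: "open V" "snd c p \<in> V" "V \<subseteq> chart_range c"
    "\<And>x. x \<in> V \<Longrightarrow> u (chart_inv c x) = x \<bullet> axis a 1"
    using smooth_local_extension [OF c p] by blast
  have "ext_d (fun_form u) c (chart_inv c x) [v] = axis a 1 \<bullet> v" if "x \<in> V" for x v
  proof -
    have "((\<lambda>x. x \<bullet> axis a 1) has_derivative (\<lambda>v. v \<bullet> axis a 1)) (at x)"
      by (auto intro!: derivative_eq_intros)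
    then have "(u \<circ> chart_inv c has_derivative (\<lambda>v. v \<bullet> axis a 1)) (at x)"
      by (rule has_derivative_transform_within_open [OF _ V(1) that]) (simp add: V)
    then show ?thesis
      using that V(3) by (auto simp: chart_deriv_def chart_right_inverse frechet_derivative_at [symmetric] inner_commute)
  qed
  with that diff_form_ext_d_fun_form [OF u] V show thesis by blast
qed

end

section \<open>The bracket of 1-forms in a chart\<close>

lemma vector_matrix_mult_nth:
  fixes m :: "real^'k::finite^'n::finite"
  shows "(v v* m) $ j = (\<Sum>i\<in>UNIV. v $ i * m $ i $ j)"
  by (simp add: vector_matrix_mult_def mult.commute)

lemma axis_vector_matrix_mult:
  fixes m :: "real^'k::finite^'n::finite"
  shows "(axis a 1 v* m) $ j = m $ a $ j"
  by (simp add: vector_matrix_mult_nth axis_def if_distrib if_distribR cong: if_cong)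

lemma linear_axis_expansion:
  fixes L :: "real^'n::finite \<Rightarrow> 'b::real_vector"
  assumes "linear L"
  shows "L v = (\<Sum>i\<in>UNIV. v $ i *\<^sub>R L (axis i 1))"
proof -
  have "L v = L (\<Sum>i\<in>UNIV. v $ i *\<^sub>R axis i 1)"
    using basis_expansion [of v] by (simp add: scalar_mult_eq_scaleR)
  then show ?thesis
    by (simp only: linear_sum [OF assms] linear_cmul [OF assms])
qed

lemma linear_entry_expansion:
  fixes L :: "real^'n::finite \<Rightarrow> real^'k::finite^'m::finite"
  assumes "linear L"
  shows "L v $ a $ b = (\<Sum>i\<in>UNIV. v $ i * L (axis i 1) $ a $ b)"
  by (subst linear_axis_expansion [OF assms]) simp

lemma bounded_bilinear_vector_matrix_mult:
  "bounded_bilinear ((v*) :: real^'n::finite \<Rightarrow> real^'m::finite^'n \<Rightarrow> real^'m)"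
  unfolding bilinear_conv_bounded_bilinear [symmetric] bilinear_def
  by (auto intro!: linearI simp: vec_eq_iff vector_matrix_mult_def sum.distrib sum_distrib_left algebra_simps)

lemma bounded_bilinear_matrix_matrix_mult:
  "bounded_bilinear ((**) :: real^'n::finite^'m::finite \<Rightarrow> real^'k::finite^'n \<Rightarrow> real^'k^'m)"
  unfolding bilinear_conv_bounded_bilinear [symmetric] bilinear_def
  by (auto intro!: linearI simp: vec_eq_iff matrix_matrix_mult_def sum.distrib sum_distrib_left algebra_simps)

lemma bounded_linear_transpose:
  "bounded_linear (transpose :: real^'n::finite^'m::finite \<Rightarrow> real^'m^'n)"
  unfolding linear_conv_bounded_linear [symmetric]
  by (auto intro!: linearI simp: vec_eq_iff transpose_def)

lemmas has_derivative_vector_matrix_mult =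
  bounded_bilinear.FDERIV [OF bounded_bilinear_vector_matrix_mult]
lemmas has_derivative_matrix_matrix_mult =
  bounded_bilinear.FDERIV [OF bounded_bilinear_matrix_matrix_mult]
lemmas has_derivative_transpose =
  bounded_linear.has_derivative [OF bounded_linear_transpose]

lemma chart_derivI:
  assumes "(g has_derivative g') (at (snd c p))" "open V" "snd c p \<in> V"
    "\<And>x. x \<in> V \<Longrightarrow> h (chart_inv c x) = g x"
  shows "chart_deriv c h p v = g' v"
proof -
  have "(h \<circ> chart_inv c has_derivative g') (at (snd c p))"
    by (rule has_derivative_transform_within_open [OF assms(1-3)]) (simp add: assms(4))
  then show ?thesis by (simp add: chart_deriv_def frechet_derivative_at [symmetric])
qed

text \<open>
  With \<open>a\<close>, \<open>b\<close> the components of \<open>\<alpha>\<close>, \<open>\<beta>\<close>, the vector fields are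
  \<open>Q\<alpha> = a v* q\<close> and \<open>Q\<beta> = b v* q\<close>. In
  \<open>L\<^bsub>Q\<alpha>\<^esub> \<beta> - L\<^bsub>Q\<beta>\<^esub> \<alpha> - d(Q(\<alpha>, \<beta>))\<close>, the derivatives of \<open>q\<close> coming from the
  first Lie derivative cancel against those of \<open>Q(\<alpha>, \<beta>) = \<beta>(Q\<alpha>)\<close>; this is why the right hand side is
  not visibly skew in \<open>\<alpha>\<close> and \<open>\<beta>\<close>.
\<close>
lemma form_bracket_in_chart:
  fixes Q :: "('a, 'n::finite) matfield"
  assumes V: "open V" "snd c p \<in> V" "chart_inv c (snd c p) = p"
    and \<alpha>: "\<And>x v. x \<in> V \<Longrightarrow> \<alpha> c (chart_inv c x) [v] = a x \<bullet> v"
    and \<beta>: "\<And>x v. x \<in> V \<Longrightarrow> \<beta> c (chart_inv c x) [v] = b x \<bullet> v"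
    and Q: "\<And>x. x \<in> V \<Longrightarrow> Q c (chart_inv c x) = q x"
    and a: "(a has_derivative a') (at (snd c p))"
    and b: "(b has_derivative b') (at (snd c p))"
    and q: "(q has_derivative q') (at (snd c p))"
  defines "x0 \<equiv> snd c p"
  shows "form_bracket Q \<alpha> \<beta> c p [v] =
    b' (a x0 v* q x0) \<bullet> v - a' (b x0 v* q x0) \<bullet> v
    - a x0 \<bullet> (b' v v* q x0 + b x0 v* q' v) - (a x0 v* q x0) \<bullet> b' v"
proof -
  have covec: "covec \<gamma> c (chart_inv c x) = g x"
    if "\<And>v. \<gamma> c (chart_inv c x) [v] = g x \<bullet> v" for \<gamma> g x
    by (simp add: covec_def that inner_axis)
  have sharp: "sharp Q \<gamma> c (chart_inv c x) = g x v* q x"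
    if "x \<in> V" "\<And>v. \<gamma> c (chart_inv c x) [v] = g x \<bullet> v" for \<gamma> g x
    using Q [OF that(1)] covec [of \<gamma> x g, OF that(2)] by (simp add: sharp_def)
  note DI = chart_derivI [OF _ V(1,2)]
  have lie: "lie_deriv (sharp Q \<gamma>) \<delta> c p [v] =
      d' (g x0 v* q x0) \<bullet> v + d x0 \<bullet> (g x0 v* q' v + g' v v* q x0)"
    if \<gamma>: "\<And>x v. x \<in> V \<Longrightarrow> \<gamma> c (chart_inv c x) [v] = g x \<bullet> v"
    and \<delta>: "\<And>x v. x \<in> V \<Longrightarrow> \<delta> c (chart_inv c x) [v] = d x \<bullet> v"
    and g: "(g has_derivative g') (at (snd c p))"
    and d: "(d has_derivative d') (at (snd c p))" for \<gamma> \<delta> g d g' d'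
  proof -
    have X: "sharp Q \<gamma> c p = g x0 v* q x0"
      using sharp [OF V(2), of \<gamma> g] \<gamma> [OF V(2)] V(3) by (simp add: x0_def)
    have "chart_deriv c (\<lambda>q. \<delta> c q [w]) p u = d' u \<bullet> w" for u w
      by (rule DI [of "\<lambda>x. d x \<bullet> w" "\<lambda>u. d' u \<bullet> w"])
        (auto intro!: derivative_eq_intros d \<delta>)
    moreover have "chart_deriv c (\<lambda>q. \<delta> c q [sharp Q \<gamma> c q]) p u
        = d x0 \<bullet> (g x0 v* q' u + g' u v* q x0) + d' u \<bullet> (g x0 v* q x0)" for u
      by (rule DI [of "\<lambda>x. d x \<bullet> (g x v* q x)"
            "\<lambda>u. d x0 \<bullet> (g x0 v* q' u + g' u v* q x0) + d' u \<bullet> (g x0 v* q x0)"])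
        (auto intro!: has_derivative_inner has_derivative_vector_matrix_mult g d q simp: sharp \<gamma> \<delta> x0_def)
    ultimately show ?thesis
      by (simp add: lie_deriv_def int_vf_def ext_d_pair ext_d_singleton X)
  qed
  have "bivec_pair Q \<alpha> \<beta> c (chart_inv c x) [] = (a x v* q x) \<bullet> b x" if "x \<in> V" for x
    using Q [OF that] covec [of \<alpha> x a, OF \<alpha> [OF that]] covec [of \<beta> x b, OF \<beta> [OF that]]
    by (simp add: bivec_pair_def zero_form_def inner_vec_def vector_matrix_mult_def
        sum_distrib_right sum_distrib_left mult_ac)
      (subst sum.swap, rule refl)
  then have "chart_deriv c (\<lambda>q. bivec_pair Q \<alpha> \<beta> c q []) p v
      = (a x0 v* q x0) \<bullet> b' v + (a x0 v* q' v + a' v v* q x0) \<bullet> b x0"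
    by (intro DI [of "\<lambda>x. (a x v* q x) \<bullet> b x"
            "\<lambda>v. (a x0 v* q x0) \<bullet> b' v + (a x0 v* q' v + a' v v* q x0) \<bullet> b x0"])
        (auto intro!: has_derivative_inner has_derivative_vector_matrix_mult a b q simp: x0_def)
  moreover have "lie_deriv (sharp Q \<alpha>) \<beta> c p [v]
      = b' (a x0 v* q x0) \<bullet> v + b x0 \<bullet> (a x0 v* q' v + a' v v* q x0)"
    by (rule lie) (simp_all add: \<alpha> \<beta> a b)
  moreover have "lie_deriv (sharp Q \<beta>) \<alpha> c p [v]
      = a' (b x0 v* q x0) \<bullet> v + a x0 \<bullet> (b x0 v* q' v + b' v v* q x0)"
    by (rule lie) (simp_all add: \<alpha> \<beta> a b)
  ultimately show ?thesis
    by (simp add: form_bracket_def ext_d_singleton inner_add_right inner_add_left inner_commute)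
qed

section \<open>The derivative of the trace\<close>

text \<open>
  Here \<open>dp l\<close> and \<open>dn l\<close> stand for the derivatives of the matrices \<open>p\<close> and \<open>n\<close> in the direction
  \<open>l\<close>. Setting \<open>l = b\<close> in the hypothesis and summing over \<open>b\<close>, the two sums with derivatives of
  \<open>p\<close> become equal and cancel, one sum produces the derivative of the trace of \<open>n\<close>, and
  by skewness of \<open>p\<close> the two remaining sums are opposite values of the same quantity. They end
  up on different sides of the equation, which is the origin of the factor \<open>1/2\<close>.
\<close>
lemma trace_identity_from_bracket:
  fixes p n :: "'n::finite \<Rightarrow> 'n \<Rightarrow> real" and dp dn :: "'n \<Rightarrow> 'n \<Rightarrow> 'n \<Rightarrow> real"
  assumes skew: "\<And>i j. p j i = - p i j"
    and bracket: "\<And>b l.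
      - (\<Sum>k\<in>UNIV. p b k * dn l a k)
      = - (\<Sum>i\<in>UNIV. p b i * dn i a l) + (\<Sum>i\<in>UNIV. p a i * dn i b l)
        - (\<Sum>k\<in>UNIV. n b k * dp l k a) + (\<Sum>m\<in>UNIV. n m l * dp m b a)"
  shows "(\<Sum>i\<in>UNIV. \<Sum>j\<in>UNIV. p i j * dn i a j)
       = 1/2 * (\<Sum>i\<in>UNIV. p i a * (\<Sum>l\<in>UNIV. dn i l l))"
proof -
  let ?S = "\<Sum>i\<in>UNIV. \<Sum>j\<in>UNIV. p i j * dn i a j"
  have "- ?S = (\<Sum>b\<in>UNIV. - (\<Sum>k\<in>UNIV. p b k * dn b a k))"
    by (simp add: sum_negf)
  also have "\<dots> = - (\<Sum>b\<in>UNIV. \<Sum>i\<in>UNIV. p b i * dn i a b)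
      + (\<Sum>b\<in>UNIV. \<Sum>i\<in>UNIV. p a i * dn i b b)
      - (\<Sum>b\<in>UNIV. \<Sum>k\<in>UNIV. n b k * dp b k a) + (\<Sum>b\<in>UNIV. \<Sum>m\<in>UNIV. n m b * dp m b a)"
    by (simp add: bracket sum.distrib sum_subtractf sum_negf)
  also have "(\<Sum>b\<in>UNIV. \<Sum>m\<in>UNIV. n m b * dp m b a) = (\<Sum>b\<in>UNIV. \<Sum>k\<in>UNIV. n b k * dp b k a)"
    by (rule sum.swap)
  also have "(\<Sum>b\<in>UNIV. \<Sum>i\<in>UNIV. p b i * dn i a b) = - ?S"
  proof -
    have "(\<Sum>b\<in>UNIV. \<Sum>i\<in>UNIV. p b i * dn i a b) = (\<Sum>i\<in>UNIV. \<Sum>b\<in>UNIV. p b i * dn i a b)"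
      by (rule sum.swap)
    also have "\<dots> = (\<Sum>i\<in>UNIV. \<Sum>b\<in>UNIV. - (p i b * dn i a b))"
      by (intro sum.cong refl) (metis skew mult_minus_left)
    finally show ?thesis by (simp add: sum_negf)
  qed
  also have "(\<Sum>b\<in>UNIV. \<Sum>i\<in>UNIV. p a i * dn i b b) = (\<Sum>i\<in>UNIV. \<Sum>b\<in>UNIV. p a i * dn i b b)"
    by (rule sum.swap)
  also have "\<dots> = - (\<Sum>i\<in>UNIV. p i a * (\<Sum>l\<in>UNIV. dn i l l))"
    unfolding sum_negf [symmetric] sum_distrib_left
    by (intro sum.cong refl) (metis skew mult_minus_left)
  finally show ?thesis by simp
qed

locale PN_manifold = manifold M A
  for M :: "'a topology" and A :: "('a, 'n::finite) chart set" +
  fixes P N :: "('a, 'n) matfield"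
  assumes poisson_nijenhuis: "poisson_nijenhuis A P N"
begin

lemma bivector_field_P: "bivector_field A P"
  using poisson_nijenhuis unfolding poisson_nijenhuis_def poisson_bivector_def by blast

lemma tensor11_field_N: "tensor11_field A N"
  using poisson_nijenhuis unfolding poisson_nijenhuis_def nijenhuis_tensor_def by blast

lemma PN_compatible: "PN_compatible A P N"
  using poisson_nijenhuis unfolding poisson_nijenhuis_def by blast

lemma P_skew: "c \<in> A \<Longrightarrow> p \<in> fst c \<Longrightarrow> transpose (P c p) = - P c p"
  using bivector_field_P unfolding bivector_field_def by blast

lemma P_skew_entry: "c \<in> A \<Longrightarrow> p \<in> fst c \<Longrightarrow> P c p $ j $ i = - P c p $ i $ j"
proof -
  assume "c \<in> A" "p \<in> fst c"
  then have "transpose (P c p) $ i $ j = (- P c p) $ i $ j" by (simp only: P_skew)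
  then show ?thesis by (simp add: transpose_def)
qed

lemma matfield_has_derivative:
  assumes "c \<in> A" "x \<in> chart_range c"
  obtains P' N' where "((\<lambda>x. P c (chart_inv c x)) has_derivative P') (at x)"
    "((\<lambda>x. N c (chart_inv c x)) has_derivative N') (at x)"
proof -
  have "Ck_on (Suc 0) (P c \<circ> chart_inv c) (chart_range c)"
    using bivector_field_P assms(1) unfolding bivector_field_def smooth_on_def by blast
  moreover have "Ck_on (Suc 0) (N c \<circ> chart_inv c) (chart_range c)"
    using tensor11_field_N assms(1) unfolding tensor11_field_def smooth_on_def by blast
  ultimately show thesis
    using that [OF Ck_on_SucD [OF _ assms(2), of 0] Ck_on_SucD [OF _ assms(2), of 0]]
    by (simp add: comp_def del: Ck_on.simps)
qed

text \<open>
  The two sides of \<open>N \<circ> P = P \<circ> N\<^sup>t\<close>, applied to \<open>dx\<^sup>a\<close>, are the rows \<open>a\<close> of the two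
  matrices.
\<close>
lemma NP_commute:
  assumes "c \<in> A" "p \<in> fst c"
  shows "P c p ** transpose (N c p) = N c p ** P c p"
proof -
  have "axis a 1 v* (P c p ** transpose (N c p)) = axis a 1 v* (N c p ** P c p)" for a
  proof -
    obtain \<alpha> V where \<alpha>: "diff_form A 1 \<alpha>" and V: "open V" "snd c p \<in> V" "V \<subseteq> chart_range c"
      "\<And>x v. x \<in> V \<Longrightarrow> \<alpha> c (chart_inv c x) [v] = axis a 1 \<bullet> v"
      by (rule coordinate_differential [OF assms, where a = a]) (rule that)
    have e: "\<alpha> c p [v] = axis a 1 \<bullet> v" for v
      using V(4) [OF V(2)] chart_left_inverse [OF assms] by simp
    have "covec \<alpha> c p = axis a 1"
      by (simp add: covec_def e inner_axis)
    moreover have "covec (transpose_N N \<alpha>) c p = axis a 1 v* N c p"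
      by (simp add: covec_def transpose_N_def e dot_lmul_matrix [symmetric] inner_axis)
    moreover have "act_N N (sharp P \<alpha>) c p = sharp P (transpose_N N \<alpha>) c p"
      using PN_compatible \<alpha> assms unfolding PN_compatible_def vf_eq_def by blast
    ultimately show ?thesis
      by (simp add: act_N_def sharp_def vector_matrix_mul_assoc [symmetric])
  qed
  then show ?thesis
    by (metis axis_vector_matrix_mult vec_eq_iff)
qed

text \<open>
  The component \<open>l\<close> of the bracket condition for \<open>\<alpha> = dx\<^sup>a\<close> and \<open>\<beta> = dx\<^sup>b\<close>. On both sides there is the
  term \<open>N\<^sup>a\<^sub>k \<partial>\<^sub>l P\<^sup>b\<^sup>k\<close>, which is cancelled. Skewness of \<open>P\<close> at the point removes
  \<open>P\<^sup>a\<^sup>k \<partial>\<^sub>l N\<^sup>b\<^sub>k\<close>, which occurs in the bracket of \<open>dx\<^sup>a\<close> with \<open>N\<^sup>t dx\<^sup>b\<close> a second time with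
  the indices of \<open>P\<close> exchanged.
\<close>
lemma bracket_compatibility_in_chart:
  assumes c: "c \<in> A" and p: "p \<in> fst c"
    and P': "((\<lambda>x. P c (chart_inv c x)) has_derivative P') (at (snd c p))"
    and N': "((\<lambda>x. N c (chart_inv c x)) has_derivative N') (at (snd c p))"
  shows "- (\<Sum>k\<in>UNIV. P c p $ b $ k * N' (axis l 1) $ a $ k)
    = - (\<Sum>i\<in>UNIV. P c p $ b $ i * N' (axis i 1) $ a $ l)
      + (\<Sum>i\<in>UNIV. P c p $ a $ i * N' (axis i 1) $ b $ l)
      - (\<Sum>k\<in>UNIV. N c p $ b $ k * P' (axis l 1) $ k $ a)
      + (\<Sum>m\<in>UNIV. N c p $ m $ l * P' (axis m 1) $ b $ a)"
proof -
  note inv = chart_left_inverse [OF c p]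
  let ?v = "axis l 1 :: real^'n"
  obtain \<alpha> Va where \<alpha>: "diff_form A 1 \<alpha>" and Va: "open Va" "snd c p \<in> Va" "Va \<subseteq> chart_range c"
    "\<And>x v. x \<in> Va \<Longrightarrow> \<alpha> c (chart_inv c x) [v] = axis a 1 \<bullet> v"
    by (rule coordinate_differential [OF c p, where a = a]) (rule that)
  obtain \<beta> Vb where \<beta>: "diff_form A 1 \<beta>" and Vb: "open Vb" "snd c p \<in> Vb" "Vb \<subseteq> chart_range c"
    "\<And>x v. x \<in> Vb \<Longrightarrow> \<beta> c (chart_inv c x) [v] = axis b 1 \<bullet> v"
    by (rule coordinate_differential [OF c p, where a = b]) (rule that)
  let ?V = "Va \<inter> Vb"
  have V: "open ?V" "snd c p \<in> ?V" using Va Vb by auto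
  have \<alpha>V: "\<alpha> c (chart_inv c x) [v] = axis a 1 \<bullet> v" if "x \<in> ?V" for x v using Va that by auto
  have \<beta>V: "\<beta> c (chart_inv c x) [v] = axis b 1 \<bullet> v" if "x \<in> ?V" for x v using Vb that by auto
  have N\<alpha>V: "transpose_N N \<alpha> c (chart_inv c x) [v] = (axis a 1 v* N c (chart_inv c x)) \<bullet> v"
    if "x \<in> ?V" for x v using \<alpha>V [OF that] by (simp add: transpose_N_def dot_lmul_matrix)
  have N\<beta>V: "transpose_N N \<beta> c (chart_inv c x) [v] = (axis b 1 v* N c (chart_inv c x)) \<bullet> v"
    if "x \<in> ?V" for x v using \<beta>V [OF that] by (simp add: transpose_N_def dot_lmul_matrix)
  have row: "((\<lambda>x. axis a 1 v* N c (chart_inv c x)) has_derivative (\<lambda>v. axis a 1 v* N' v)) (at (snd c p))" for a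
    using bounded_linear.has_derivative [OF bounded_bilinear.bounded_linear_right [OF bounded_bilinear_vector_matrix_mult] N'] .
  have NP': "((\<lambda>x. bivec_NP N P c (chart_inv c x)) has_derivative
      (\<lambda>v. P c p ** transpose (N' v) + P' v ** transpose (N c p))) (at (snd c p))"
    unfolding bivec_NP_def
    using has_derivative_matrix_matrix_mult [OF P' has_derivative_transpose [OF N']] by (simp add: inv)
  note bracket = form_bracket_in_chart [OF V inv]
  have 0: "form_bracket (bivec_NP N P) \<alpha> \<beta> c p [?v] =
      form_bracket P (transpose_N N \<alpha>) \<beta> c p [?v] + form_bracket P \<alpha> (transpose_N N \<beta>) c p [?v]
      - form_bracket P \<alpha> \<beta> c p [N c p *v ?v]"
    using PN_compatible \<alpha> \<beta> c p
    unfolding PN_compatible_def form_eq_def transpose_N_def [of N "form_bracket P _ _"] by simp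
  have 1: "form_bracket (bivec_NP N P) \<alpha> \<beta> c p [?v]
     = - (\<Sum>k\<in>UNIV. P c p $ b $ k * N' ?v $ a $ k) - (\<Sum>k\<in>UNIV. P' ?v $ b $ k * N c p $ a $ k)"
    by (subst bracket [where \<alpha> = \<alpha> and \<beta> = \<beta>
        and Q = "bivec_NP N P" and q = "\<lambda>x. bivec_NP N P c (chart_inv c x)"
        and a = "\<lambda>x. axis a 1" and b = "\<lambda>x. axis b 1",
        OF \<alpha>V \<beta>V refl has_derivative_const has_derivative_const NP'])
      (simp_all add: inner_axis' axis_vector_matrix_mult matrix_matrix_mult_def transpose_def)
  have 2: "form_bracket P (transpose_N N \<alpha>) \<beta> c p [?v]
     = - (\<Sum>i\<in>UNIV. P c p $ b $ i * N' (axis i 1) $ a $ l) - (\<Sum>k\<in>UNIV. N c p $ a $ k * P' ?v $ b $ k)"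
    by (subst bracket [where \<alpha> = "transpose_N N \<alpha>" and \<beta> = \<beta>
        and Q = P and q = "\<lambda>x. P c (chart_inv c x)"
        and a = "\<lambda>x. axis a 1 v* N c (chart_inv c x)" and b = "\<lambda>x. axis b 1",
        OF N\<alpha>V \<beta>V refl row has_derivative_const P'])
      (simp_all add: inv inner_axis inner_axis' axis_vector_matrix_mult inner_vec_def [of "_ v* _" "_ v* _"]
        vector_matrix_mult_nth [of "_ v* _"] matrix_vector_mul_component
        linear_entry_expansion [OF has_derivative_linear [OF N'], of "axis b 1 v* P c p"])
  have 3: "form_bracket P \<alpha> (transpose_N N \<beta>) c p [?v]
     = (\<Sum>i\<in>UNIV. P c p $ a $ i * N' (axis i 1) $ b $ l)
       - (\<Sum>k\<in>UNIV. N' ?v $ b $ k * P c p $ k $ a)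
       - (\<Sum>k\<in>UNIV. N c p $ b $ k * P' ?v $ k $ a)
       - (\<Sum>k\<in>UNIV. P c p $ a $ k * N' ?v $ b $ k)"
    by (subst bracket [where \<alpha> = \<alpha> and \<beta> = "transpose_N N \<beta>"
        and Q = P and q = "\<lambda>x. P c (chart_inv c x)"
        and a = "\<lambda>x. axis a 1" and b = "\<lambda>x. axis b 1 v* N c (chart_inv c x)",
        OF \<alpha>V N\<beta>V refl has_derivative_const row P'])
      (simp_all add: inv inner_axis inner_axis' axis_vector_matrix_mult inner_vec_def [of "_ v* _" "_ v* _"]
        vector_matrix_mult_nth [of "_ v* _"] matrix_vector_mul_component
        linear_entry_expansion [OF has_derivative_linear [OF N'], of "axis a 1 v* P c p"])
  have 4: "form_bracket P \<alpha> \<beta> c p [N c p *v ?v] = - (\<Sum>m\<in>UNIV. N c p $ m $ l * P' (axis m 1) $ b $ a)"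
    by (subst bracket [where \<alpha> = \<alpha> and \<beta> = \<beta>
        and Q = P and q = "\<lambda>x. P c (chart_inv c x)"
        and a = "\<lambda>x. axis a 1" and b = "\<lambda>x. axis b 1",
        OF \<alpha>V \<beta>V refl has_derivative_const has_derivative_const P'])
      (simp_all add: inv inner_axis inner_axis' axis_vector_matrix_mult inner_vec_def [of "_ v* _" "_ v* _"]
        vector_matrix_mult_nth [of "_ v* _"] matrix_vector_mul_component
        linear_entry_expansion [OF has_derivative_linear [OF P'], of "N c p *v ?v"])
  have "(\<Sum>k\<in>UNIV. N' ?v $ b $ k * P c p $ k $ a) = - (\<Sum>k\<in>UNIV. P c p $ a $ k * N' ?v $ b $ k)"
    unfolding sum_negf [symmetric]
  proof (rule sum.cong [OF refl])
    fix k
    have "P c p $ k $ a = - P c p $ a $ k"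
      using P_skew_entry [OF c p] .
    then show "N' ?v $ b $ k * P c p $ k $ a = - (P c p $ a $ k * N' ?v $ b $ k)" by simp
  qed
  with 0 show ?thesis
    unfolding 1 2 3 4 by (simp add: mult.commute [of "N c p $ a $ _"])
qed

end

section \<open>The interior product of P with the deformed differential\<close>

lemma skew_contraction_symmetric:
  fixes q h :: "'n::finite \<Rightarrow> 'n \<Rightarrow> real"
  assumes "\<And>i j. q j i = - q i j" and "\<And>i j. h j i = h i j"
  shows "(\<Sum>i\<in>UNIV. \<Sum>j\<in>UNIV. q i j * h i j) = 0"
proof -
  let ?S = "\<Sum>i\<in>UNIV. \<Sum>j\<in>UNIV. q i j * h i j"
  have "?S = (\<Sum>j\<in>UNIV. \<Sum>i\<in>UNIV. q i j * h i j)" by (rule sum.swap)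
  also have "\<dots> = (\<Sum>j\<in>UNIV. \<Sum>i\<in>UNIV. - (q j i * h j i))"
  proof (intro sum.cong refl)
    fix i j
    show "q i j * h i j = - (q j i * h j i)"
      using assms(1) [of i j] assms(2) [of i j] by simp
  qed
  also have "\<dots> = - ?S" by (simp add: sum_negf)
  finally show ?thesis by simp
qed

text \<open>
  The double sum in \<open>i\<^sub>P\<close> counts both parts of an alternating expression; this absorbs the factor
  \<open>1/2\<close> in its definition.
\<close>
lemma skew_contraction_alternation:
  fixes q t :: "'n::finite \<Rightarrow> 'n \<Rightarrow> real"
  assumes "\<And>i j. q j i = - q i j"
  shows "1/2 * (\<Sum>i\<in>UNIV. \<Sum>j\<in>UNIV. q i j * - (t i j - t j i)) = - (\<Sum>i\<in>UNIV. \<Sum>j\<in>UNIV. q i j * t i j)"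
proof -
  have "(\<Sum>i\<in>UNIV. \<Sum>j\<in>UNIV. q i j * (t i j + t j i)) = 0"
    by (rule skew_contraction_symmetric [OF assms]) simp
  then show ?thesis
    by (simp add: distrib_left right_diff_distrib sum.distrib sum_subtractf sum_negf)
qed

context PN_manifold
begin

context
  fixes c p P' N'
  assumes c: "c \<in> A" and p: "p \<in> fst c"
    and P': "((\<lambda>x. P c (chart_inv c x)) has_derivative P') (at (snd c p))"
    and N': "((\<lambda>x. N c (chart_inv c x)) has_derivative N') (at (snd c p))"
begin

lemma contracted_derivative_N:
  "(\<Sum>i\<in>UNIV. \<Sum>j\<in>UNIV. P c p $ i $ j * N' (axis i 1) $ a $ j)
   = 1/2 * (\<Sum>i\<in>UNIV. P c p $ i $ a * trace (N' (axis i 1)))"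
  unfolding trace_def
  by (rule trace_identity_from_bracket
      [where p = "\<lambda>i j. P c p $ i $ j" and n = "\<lambda>i j. N c p $ i $ j"
        and dp = "\<lambda>l i j. P' (axis l 1) $ i $ j" and dn = "\<lambda>l i j. N' (axis l 1) $ i $ j"])
    (rule P_skew_entry [OF c p], rule bracket_compatibility_in_chart [OF c p P' N'])

lemma covec_d_trace: "covec (ext_d (trace_N N)) c p $ i = trace (N' (axis i 1))"
proof -
  have "chart_deriv c (\<lambda>q. trace (N c q)) p v = trace (N' v)" for v
  proof (rule chart_derivI [OF _ open_chart_range [OF c] chart_range_in [OF p] refl])
    show "((\<lambda>x. trace (N c (chart_inv c x))) has_derivative (\<lambda>v. trace (N' v))) (at (snd c p))"
      unfolding trace_def
      by (intro has_derivative_sum bounded_linear.has_derivative [OF bounded_linear_vec_nth] N')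
  qed
  then show ?thesis
    by (simp add: covec_def ext_d_singleton trace_N_def zero_form_def)
qed

text \<open>
  Since \<open>ddf = 0\<close>, only \<open>- d(i\<^sub>N df)\<close> remains of \<open>d\<^sub>N df\<close>, and its contraction with \<open>P\<close> is
  \<open>- P\<^sup>i\<^sup>j \<partial>\<^sub>i (N\<^sup>k\<^sub>j \<partial>\<^sub>k f)\<close>. The second derivatives of \<open>f\<close> are contracted with the matrix
  \<open>P N\<^sup>t = N P\<close>, which is skew, and drop out. What remains is
  the contraction that \<open>contracted_derivative_N\<close> evaluates.
\<close>
lemma int_P_d_N_ext_d_in_chart:
  assumes f: "smooth_fun A f"
  shows "int_P P (d_N N (ext_d (fun_form f))) c p []
    = - (1/2) * vf_apply (hamiltonian_vf P (trace_N N)) f c p"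
proof -
  \<comment> \<open>\<open>D x v\<close> is the derivative of \<open>f\<close> in coordinates, \<open>H\<close> its Hessian at \<open>p\<close>, and \<open>T i j\<close> below is
      the derivative in the direction \<open>i\<close> of the component \<open>j\<close> of \<open>i\<^sub>N df\<close>.\<close>
  define D where "D x v = frechet_derivative (f \<circ> chart_inv c) (at x) v" for x v
  define H where "H k i = frechet_derivative (\<lambda>x. D x (axis k 1)) (at (snd c p)) (axis i 1)" for k i
  note dom = open_chart_range [OF c] chart_range_in [OF p]
  note C2 = smooth_funD [OF f c, of "Suc (Suc 0)"]
  have H_sym: "H j i = H i j" for i j
    unfolding H_def D_def by (rule second_derivative_symmetric [OF C2 dom])
  have D': "((\<lambda>x. D x v) has_derivative frechet_derivative (\<lambda>x. D x v) (at (snd c p))) (at (snd c p))" for v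
    unfolding D_def by (rule Ck_on_SucD [where k = 0, OF _ dom(2)]) (use C2 in auto)
  have D_expand: "D x v = (\<Sum>k\<in>UNIV. v $ k * D x (axis k 1))" if "x \<in> chart_range c" for x v
    using linear_axis_expansion [OF has_derivative_linear [OF Ck_on_SucD [OF C2 that]], of v]
    by (simp add: D_def)
  have df: "ext_d (fun_form f) c (chart_inv c x) [v] = D x v" if "x \<in> chart_range c" for x v
    using that by (simp add: chart_deriv_def D_def chart_right_inverse)
  define T where "T i j = (\<Sum>k\<in>UNIV. N' (axis i 1) $ k $ j * D (snd c p) (axis k 1) + N c p $ k $ j * H k i)" for i j
  have T: "chart_deriv c (\<lambda>q. int_N N (ext_d (fun_form f)) c q [axis j 1]) p (axis i 1) = T i j" for i j
    unfolding T_def H_def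
  proof (rule chart_derivI [OF _ dom])
    show "((\<lambda>x. \<Sum>k\<in>UNIV. N c (chart_inv c x) $ k $ j * D x (axis k 1)) has_derivative
        (\<lambda>v. \<Sum>k\<in>UNIV. N' v $ k $ j * D (snd c p) (axis k 1)
          + N c p $ k $ j * frechet_derivative (\<lambda>x. D x (axis k 1)) (at (snd c p)) v)) (at (snd c p))"
      by (intro has_derivative_sum, rule has_derivative_eq_rhs,
          rule has_derivative_mult [OF bounded_linear.has_derivative [OF bounded_linear_vec_nth
            bounded_linear.has_derivative [OF bounded_linear_vec_nth N']] D'])
        (simp add: fun_eq_iff chart_left_inverse [OF c p] algebra_simps)
    show "int_N N (ext_d (fun_form f)) c (chart_inv c x) [axis j 1]
        = (\<Sum>k\<in>UNIV. N c (chart_inv c x) $ k $ j * D x (axis k 1))" if "x \<in> chart_range c" for x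
      using that D_expand [OF that, of "column j (N c (chart_inv c x))"]
      by (simp add: int_N_def df matrix_vector_mult_basis column_def del: ext_d_fun_form)
  qed
  have "ext_d (ext_d (fun_form f)) c p [v, w] = 0" for v w
  proof -
    have "chart_deriv c (\<lambda>q. ext_d (fun_form f) c q [w]) p v
        = frechet_derivative (\<lambda>x. D x w) (at (snd c p)) v" for v w
      by (rule chart_derivI [OF D' dom df])
    moreover have "frechet_derivative (\<lambda>x. D x w) (at (snd c p)) v
        = frechet_derivative (\<lambda>x. D x v) (at (snd c p)) w"
      unfolding D_def by (rule second_derivative_symmetric [OF C2 dom])
    ultimately show ?thesis
      by (simp add: ext_d_pair del: ext_d_fun_form)
  qed
  then have "d_N N (ext_d (fun_form f)) c p [axis i 1, axis j 1] = - (T i j - T j i)" for i j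
    by (simp add: d_N_def int_N_def [of N "ext_d (ext_d _)"] numeral_2_eq_2 lessThan_Suc ext_d_pair [of "int_N _ _"] T)
  then have "int_P P (d_N N (ext_d (fun_form f))) c p []
      = 1/2 * (\<Sum>i\<in>UNIV. \<Sum>j\<in>UNIV. P c p $ i $ j * - (T i j - T j i))"
    by (simp add: int_P_def)
  also have "\<dots> = - (\<Sum>i\<in>UNIV. \<Sum>j\<in>UNIV. P c p $ i $ j * T i j)"
    by (rule skew_contraction_alternation) (rule P_skew_entry [OF c p])
  also have "(\<Sum>i\<in>UNIV. \<Sum>j\<in>UNIV. P c p $ i $ j * T i j)
      = (\<Sum>k\<in>UNIV. D (snd c p) (axis k 1) * (\<Sum>i\<in>UNIV. \<Sum>j\<in>UNIV. P c p $ i $ j * N' (axis i 1) $ k $ j))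
        + (\<Sum>i\<in>UNIV. \<Sum>k\<in>UNIV. (P c p ** transpose (N c p)) $ i $ k * H k i)"
  proof -
    have "(\<Sum>i\<in>UNIV. \<Sum>j\<in>UNIV. P c p $ i $ j * T i j)
      = (\<Sum>i\<in>UNIV. \<Sum>j\<in>UNIV. \<Sum>k\<in>UNIV. D (snd c p) (axis k 1) * (P c p $ i $ j * N' (axis i 1) $ k $ j))
        + (\<Sum>i\<in>UNIV. \<Sum>j\<in>UNIV. \<Sum>k\<in>UNIV. P c p $ i $ j * N c p $ k $ j * H k i)"
      by (simp add: T_def sum_distrib_left sum.distrib algebra_simps)
    also have "(\<Sum>i\<in>UNIV. \<Sum>j\<in>UNIV. \<Sum>k\<in>UNIV. D (snd c p) (axis k 1) * (P c p $ i $ j * N' (axis i 1) $ k $ j))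
      = (\<Sum>k\<in>UNIV. \<Sum>i\<in>UNIV. \<Sum>j\<in>UNIV. D (snd c p) (axis k 1) * (P c p $ i $ j * N' (axis i 1) $ k $ j))"
      by (rule trans [OF sum.cong [OF refl sum.swap] sum.swap])
    also have "(\<Sum>i\<in>UNIV. \<Sum>j\<in>UNIV. \<Sum>k\<in>UNIV. P c p $ i $ j * N c p $ k $ j * H k i)
      = (\<Sum>i\<in>UNIV. \<Sum>k\<in>UNIV. \<Sum>j\<in>UNIV. P c p $ i $ j * N c p $ k $ j * H k i)"
      by (intro sum.cong refl sum.swap)
    finally show ?thesis
      by (simp add: sum_distrib_left sum_distrib_right matrix_matrix_mult_def transpose_def)
  qed
  also have "(\<Sum>i\<in>UNIV. \<Sum>k\<in>UNIV. (P c p ** transpose (N c p)) $ i $ k * H k i) = 0"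
  proof (rule skew_contraction_symmetric)
    fix i j
    have "transpose (P c p ** transpose (N c p)) = N c p ** (- P c p)"
      by (simp add: matrix_transpose_mul P_skew [OF c p])
    also have "\<dots> = - (N c p ** P c p)"
      by (simp add: vec_eq_iff matrix_matrix_mult_def sum_negf)
    finally have "transpose (P c p ** transpose (N c p)) = - (P c p ** transpose (N c p))"
      by (simp only: NP_commute [OF c p])
    then have "transpose (P c p ** transpose (N c p)) $ i $ j = (- (P c p ** transpose (N c p))) $ i $ j"
      by (rule arg_cong [where f = "\<lambda>m. m $ i $ j"])
    then show "(P c p ** transpose (N c p)) $ j $ i = - (P c p ** transpose (N c p)) $ i $ j"
      unfolding transpose_def [of "_ ** _"] by simp
  qed (rule H_sym)
  also have "(\<Sum>k\<in>UNIV. D (snd c p) (axis k 1) * (\<Sum>i\<in>UNIV. \<Sum>j\<in>UNIV. P c p $ i $ j * N' (axis i 1) $ k $ j))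
      = 1/2 * (\<Sum>k\<in>UNIV. (\<Sum>i\<in>UNIV. trace (N' (axis i 1)) * P c p $ i $ k) * D (snd c p) (axis k 1))"
    by (simp add: contracted_derivative_N sum_distrib_left mult_ac)
  also have "(\<Sum>k\<in>UNIV. (\<Sum>i\<in>UNIV. trace (N' (axis i 1)) * P c p $ i $ k) * D (snd c p) (axis k 1))
      = vf_apply (hamiltonian_vf P (trace_N N)) f c p"
    unfolding vf_apply_def hamiltonian_vf_def sharp_def chart_deriv_def D_def [symmetric]
    by (subst D_expand [OF dom(2)]) (simp add: vector_matrix_mult_nth covec_d_trace)
  finally show ?thesis by simp
qed

end

end

theorem corollary1p1:
  fixes M :: "'a topology"
    and A :: "('a, 'n::finite) chart set"
    and P N :: "('a, 'n) matfield"
    and f :: "'a \<Rightarrow> real"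
  assumes "smooth_manifold M A"
    and "poisson_nijenhuis A P N"
    and "smooth_fun A f"
  shows "form_eq A
    (int_P P (d_N N (ext_d (fun_form f))))
    (zero_form (\<lambda>c p. - (1/2) * vf_apply (hamiltonian_vf P (trace_N N)) f c p))"
  unfolding form_eq_def
proof (intro ballI allI)
  interpret PN_manifold M A P N
    using assms(1,2) by unfold_locales
  fix c p and vs :: "(real^'n) list"
  assume c: "c \<in> A" and p: "p \<in> fst c"
  obtain P' N' where "((\<lambda>x. P c (chart_inv c x)) has_derivative P') (at (snd c p))"
    "((\<lambda>x. N c (chart_inv c x)) has_derivative N') (at (snd c p))"
    by (rule matfield_has_derivative [OF c chart_range_in [OF p]])
  from int_P_d_N_ext_d_in_chart [OF c p this assms(3)]
  show "int_P P (d_N N (ext_d (fun_form f))) c p vs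
    = zero_form (\<lambda>c p. - (1/2) * vf_apply (hamiltonian_vf P (trace_N N)) f c p) c p vs"
    by (cases "vs = []") (simp_all add: zero_form_def int_P_d_N_ext_d_degree)
qed

end
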